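(* Let $M$ be a (nonempty) compact metric space, $f\colon M\to M$ a continuous map, $X=(X,\lVert\cdot\rVert)$ a separable Banach space, and $\mathcal{A}\colon M\times\mathbb{N}_0\to B(X)$ a cocycle over $f$ whose generator $A\colon M\to B(X)$, $A(q)=\mathcal{A}(q,1)$, is continuous (with respect to the operator norm on $B(X)$). Then the following properties are equivalent: (1) there exist a Borel-measurable function $C\colon M\to(0,\infty)$, a full-measure set $E\subset M$ and $p>0$ such that \[ \bigg(\sum_{n=0}^\infty \lVert \mathcal{A}(q,n)x\rVert^p\bigg)^{1/p}\le C(q)\lVert x\rVert \] for each $q\in E$ and $x\in X$; (2) $\mathcal{A}$ is uniformly exponentially stable, i.e. there exist $D,\lambda>0$ such that \[ \lVert\mathcal{A}(q,n)\rVert\le De^{-\lambda n}\quad\text{for every }q\in M\text{ and }n\in\mathbb{N}_0. \]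
   Context: $\mathbb{N}_0=\{0,1,2,\ldots\}$ and $B(X)$ is the space of all bounded linear operators on $X$. A map $\mathcal{A}\colon M\times\mathbb{N}_0\to B(X)$ is a cocycle over $f$ if: (i) $\mathcal{A}(q,0)=\mathrm{Id}$ for each $q\in M$; (ii) $\mathcal{A}(q,n+m)=\mathcal{A}(f^m(q),n)\mathcal{A}(q,m)$ for each $q\in M$ and $n,m\in\mathbb{N}_0$; (iii) the map $A\colon M\to B(X)$, $A(q)=\mathcal{A}(q,1)$, is strongly continuous, i.e. $q\mapsto A(q)x$ is continuous for each $x\in X$ (in this theorem the stronger norm continuity of $A$ is assumed). Let $\mathcal{E}(f)$ denote the set of all ergodic $f$-invariant Borel probability measures on $M$. A Borel subset $E\subset M$ has full-measure if $\mu(E)=1$ for every $\mu\in\mathcal{E}(f)$. *)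

theory Defs
  imports "HOL-Probability.Probability"
begin

definition cocycle_over ::
  "('m::topological_space \<Rightarrow> 'm) \<Rightarrow> ('m \<Rightarrow> nat \<Rightarrow> 'x::real_normed_vector \<Rightarrow>\<^sub>L 'x) \<Rightarrow> bool"
where
  "cocycle_over f \<A> \<longleftrightarrow>
     (\<forall>q. \<A> q 0 = id_blinfun) \<and>
     (\<forall>q n m. \<A> q (n + m) = \<A> ((f ^^ m) q) n o\<^sub>L \<A> q m) \<and>
     (\<forall>x. continuous_on UNIV (\<lambda>q. blinfun_apply (\<A> q 1) x))"

definition invariant_prob_measures :: "('m::topological_space \<Rightarrow> 'm) \<Rightarrow> 'm measure set" where
  "invariant_prob_measures f =
     {\<mu>. prob_space \<mu> \<and> sets \<mu> = sets borel \<and>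
          (\<forall>B \<in> sets borel. emeasure \<mu> (f -` B) = emeasure \<mu> B)}"

definition ergodic_prob_measures :: "('m::topological_space \<Rightarrow> 'm) \<Rightarrow> 'm measure set" where
  "ergodic_prob_measures f =
     {\<mu> \<in> invariant_prob_measures f.
          \<forall>B \<in> sets borel. f -` B = B \<longrightarrow> measure \<mu> B = 0 \<or> measure \<mu> B = 1}"

definition full_measure :: "('m::topological_space \<Rightarrow> 'm) \<Rightarrow> 'm set \<Rightarrow> bool" where
  "full_measure f E \<longleftrightarrow>
     E \<in> sets borel \<and> (\<forall>\<mu> \<in> ergodic_prob_measures f. measure \<mu> E = 1)"

definition uniformly_exponentially_stable ::
  "('m \<Rightarrow> nat \<Rightarrow> 'x::real_normed_vector \<Rightarrow>\<^sub>L 'x) \<Rightarrow> bool"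
where
  "uniformly_exponentially_stable \<A> \<longleftrightarrow>
     (\<exists>D l :: real. D > 0 \<and> l > 0 \<and> (\<forall>q n. norm (\<A> q n) \<le> D * exp (- l * real n)))"

end

theory Submission
  imports Defs
begin

text \<open>Let \<open>\<gamma>\<close> be the maximal exponential growth rate of the cocycle. If the cocycle is not uniformly
  exponentially stable, then \<open>\<gamma> \<ge> 0\<close>. The invariant probability measures of growth rate \<open>\<gamma>\<close> form a
  nonempty closed face of the set of all invariant probability measures; an extreme point of it is
  ergodic. Existence of an extreme point is proved for linear functionals on the continuous functions
  (Hahn--Banach and Krein--Milman combined), and the measure is recovered by Riesz representation.

  On the other hand, for an ergodic \<open>\<nu>\<close> choose a set \<open>S\<close> of positive measure on which \<open>C \<le> K\<close>. By Datko's
  argument the norm is halved after a fixed number of visits to \<open>S\<close>, and between visits it grows at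
  most by a factor \<open>K\<close>. As \<open>\<nu>\<close>-almost every orbit reaches \<open>S\<close>, and the mean number of visits before time
  \<open>n\<close> is \<open>n \<nu>(S)\<close>, the integral of the log-norm is eventually negative. This contradicts \<open>\<gamma> \<ge> 0\<close>.\<close>

section \<open>Extreme linear functionals below a sublinear functional\<close>

text \<open>The hypothesis speaks only about points of \<open>E\<close>, which is not assumed
  invariant, and with a constant \<open>C\<close> that may be unbounded. No estimate is uniform in
  the starting point, so decay has to be read off from the return times to a sublevel set of
  \<open>C\<close>. Moreover full-measure sets are tested only by ergodic measures; an invariant
  measure of growth rate \<gamma> may give \<open>E\<close> no mass that is known in advance, and
  this is why an extreme point is sought. The growth rate of a measure enters only through the
  inequalities saying that the integral of \<open>b m\<close> is at least
  \<open>real m * \<gamma>\<close> for every m. Each of them is a closed condition on the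
  functional, and subadditivity makes them cut out a face together. In the final contradiction two
  limits are taken in order. For a fixed horizon T the time n tends to infinity, with only the crude
  exponential bound on the points that do not reach \<open>S\<close> by time T; this compares the
  slopes in n. Then T tends to infinity and the mass of those points vanishes.\<close>

definition sublinear :: "('v::real_vector \<Rightarrow> real) \<Rightarrow> bool" where
  "sublinear p \<longleftrightarrow> (\<forall>x y. p (x + y) \<le> p x + p y) \<and> (\<forall>c x. c \<ge> 0 \<longrightarrow> p (c *\<^sub>R x) = c * p x)"

lemma sublinear_add: "sublinear p \<Longrightarrow> p (x + y) \<le> p x + p y"
  by (auto simp: sublinear_def)

lemma sublinear_scale: "sublinear p \<Longrightarrow> c \<ge> 0 \<Longrightarrow> p (c *\<^sub>R x) = c * p x"
  by (auto simp: sublinear_def)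

lemma sublinear_zero: "sublinear p \<Longrightarrow> p 0 = 0"
  using sublinear_scale[of p 0 0] by simp

text \<open>Using the scaling inequality with \<open>inverse c\<close> gives the reverse one, so for
  functionals defined as infima or suprema one direction suffices.\<close>

lemma sublinearI:
  assumes add: "\<And>x y. p (x + y) \<le> p x + p y"
    and scale: "\<And>c x. c > 0 \<Longrightarrow> p (c *\<^sub>R x) \<le> c * p x"
    and zero: "p 0 = 0"
  shows "sublinear p"
  unfolding sublinear_def
proof (intro conjI allI impI)
  fix c :: real and x assume "c \<ge> 0"
  then consider "c = 0" | "c > 0" by linarith
  then show "p (c *\<^sub>R x) = c * p x"
  proof cases
    case c: 2
    have "p x \<le> inverse c * p (c *\<^sub>R x)"
      using scale[of "inverse c" "c *\<^sub>R x"] c by simp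
    with scale[OF c, of x] c show ?thesis by (simp add: field_simps)
  qed (simp add: zero)
qed (rule add)

lemma sublinear_minus: "sublinear p \<Longrightarrow> - p (- x) \<le> p x"
  using sublinear_add[of p x "- x"] sublinear_zero[of p] by simp

text \<open>The linear functionals below \<open>sublinear_face p z\<close> are those below \<open>p\<close> that attain \<open>p\<close> at \<open>z\<close>.\<close>

definition sublinear_face :: "('v::real_vector \<Rightarrow> real) \<Rightarrow> 'v \<Rightarrow> 'v \<Rightarrow> real" where
  "sublinear_face p z x = Inf ((\<lambda>t. p (x + t *\<^sub>R z) - t * p z) ` {0..})"

text \<open>A lower bound independent of t, so the infimum in \<open>sublinear_face\<close> is a
  genuine real greatest lower bound.\<close>

lemma sublinear_face_lower:
  assumes "sublinear p" "t \<ge> 0"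
  shows "- p (- x) \<le> p (x + t *\<^sub>R z) - t * p z"
  using sublinear_add[OF assms(1), of "x + t *\<^sub>R z" "- x"] sublinear_scale[OF assms, of z] by simp

lemma sublinear_face_le:
  assumes "sublinear p" "t \<ge> 0"
  shows "sublinear_face p z x \<le> p (x + t *\<^sub>R z) - t * p z"
  unfolding sublinear_face_def
  by (rule cINF_lower) (use assms in \<open>auto intro!: bdd_belowI2 sublinear_face_lower\<close>)

lemma sublinear_face_greatest:
  assumes "\<And>t. t \<ge> 0 \<Longrightarrow> a \<le> p (x + t *\<^sub>R z) - t * p z"
  shows "a \<le> sublinear_face p z x"
  unfolding sublinear_face_def by (rule cINF_greatest) (use assms in auto)

lemma sublinear_sublinear_face:
  assumes p: "sublinear p"
  shows "sublinear (sublinear_face p z)"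
proof (rule sublinearI)
  fix x y
  \<comment> \<open>Parameters s for x and t for y combine to s + t for x + y; the two infima are
    then taken one after the other.\<close>
  have *: "sublinear_face p z (x + y) \<le> (p (x + s *\<^sub>R z) - s * p z) + (p (y + t *\<^sub>R z) - t * p z)"
    if "s \<ge> 0" "t \<ge> 0" for s t
  proof -
    have "p ((x + y) + (s + t) *\<^sub>R z) \<le> p (x + s *\<^sub>R z) + p (y + t *\<^sub>R z)"
      using sublinear_add[OF p, of "x + s *\<^sub>R z" "y + t *\<^sub>R z"] by (simp add: algebra_simps)
    with sublinear_face_le[OF p, of "s + t" z "x + y"] that show ?thesis
      by (simp add: algebra_simps)
  qed
  have "sublinear_face p z (x + y) - sublinear_face p z y \<le> p (x + s *\<^sub>R z) - s * p z"
    if "s \<ge> 0" for s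
  proof -
    have "sublinear_face p z (x + y) - (p (x + s *\<^sub>R z) - s * p z) \<le> sublinear_face p z y"
      by (rule sublinear_face_greatest) (use *[OF that] in \<open>auto simp: algebra_simps\<close>)
    then show ?thesis by simp
  qed
  then have "sublinear_face p z (x + y) - sublinear_face p z y \<le> sublinear_face p z x"
    by (rule sublinear_face_greatest)
  then show "sublinear_face p z (x + y) \<le> sublinear_face p z x + sublinear_face p z y"
    by simp
next
  fix c :: real and x assume c: "c > 0"
  have "sublinear_face p z (c *\<^sub>R x) / c \<le> sublinear_face p z x"
  proof (rule sublinear_face_greatest)
    fix t :: real assume t: "t \<ge> 0"
    have "sublinear_face p z (c *\<^sub>R x) \<le> p (c *\<^sub>R x + (c * t) *\<^sub>R z) - c * t * p z"
      using c t by (intro sublinear_face_le[OF p]) auto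
    also have "p (c *\<^sub>R x + (c * t) *\<^sub>R z) = c * p (x + t *\<^sub>R z)"
      using sublinear_scale[OF p, of c "x + t *\<^sub>R z"] c by (simp add: scaleR_add_right)
    finally show "sublinear_face p z (c *\<^sub>R x) / c \<le> p (x + t *\<^sub>R z) - t * p z"
      using c by (simp add: field_simps)
  qed
  then show "sublinear_face p z (c *\<^sub>R x) \<le> c * sublinear_face p z x"
    using c by (simp add: field_simps)
next
  show "sublinear_face p z 0 = 0"
  proof (rule antisym)
    show "sublinear_face p z 0 \<le> 0"
      using sublinear_face_le[OF p, of 0 z 0] sublinear_zero[OF p] by simp
    show "0 \<le> sublinear_face p z 0"
      by (rule sublinear_face_greatest) (simp add: sublinear_scale[OF p])
  qed
qed

lemma linear_le_sublinear_face_iff: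
  assumes p: "sublinear p" and l: "linear l"
  shows "(\<forall>x. l x \<le> sublinear_face p z x) \<longleftrightarrow> (\<forall>x. l x \<le> p x) \<and> l z = p z"
proof (intro iffI conjI allI)
  assume le: "\<forall>x. l x \<le> sublinear_face p z x"
  show 1: "l x \<le> p x" for x
    using le[rule_format, of x] sublinear_face_le[OF p, of 0 z x] by simp
  \<comment> \<open>At the vector -z the parameter t = 1 leaves \<open>p 0 - p z\<close>.\<close>
  have "l (- z) \<le> - p z"
    using le[rule_format, of "- z"] sublinear_face_le[OF p, of 1 z "- z"] sublinear_zero[OF p] by simp
  then show "l z = p z" using 1[of z] by (simp add: linear_neg[OF l])
next
  fix x assume le: "(\<forall>x. l x \<le> p x) \<and> l z = p z"
  show "l x \<le> sublinear_face p z x"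
  proof (rule sublinear_face_greatest)
    fix t :: real
    show "l x \<le> p (x + t *\<^sub>R z) - t * p z"
      using le[THEN conjunct1, rule_format, of "x + t *\<^sub>R z"] le
      by (simp add: linear_add[OF l] linear_scale[OF l])
  qed
qed

text \<open>Supplies the bounds of chains for Zorn's lemma. The values stay above
  \<open>- p0 (- x)\<close>, so the infimum is finite; for subadditivity, members p and q used at x
  and at y are both replaced by the smaller of the two.\<close>

lemma sublinear_chain_Inf:
  assumes C: "C \<noteq> {}" "\<And>p. p \<in> C \<Longrightarrow> sublinear p" "\<And>p. p \<in> C \<Longrightarrow> p \<le> p0"
    and chain: "\<And>p q. p \<in> C \<Longrightarrow> q \<in> C \<Longrightarrow> p \<le> q \<or> q \<le> p"
  defines "u \<equiv> (\<lambda>x. INF p\<in>C. p x)"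
  shows "sublinear u" and "\<And>p. p \<in> C \<Longrightarrow> u \<le> p"
proof -
  have lower: "- p0 (- x) \<le> p x" if "p \<in> C" for p x
    using sublinear_minus[OF C(2)[OF that], of x] C(3)[OF that] by (auto simp: le_fun_def intro: order_trans[rotated])
  then have bdd: "bdd_below ((\<lambda>p. p x) ` C)" for x
    by (intro bdd_belowI2)
  have le: "u x \<le> p x" if "p \<in> C" for p x
    unfolding u_def by (rule cINF_lower[OF bdd that])
  then show "\<And>p. p \<in> C \<Longrightarrow> u \<le> p" by (simp add: le_fun_def)
  have greatest: "a \<le> u x" if "\<And>p. p \<in> C \<Longrightarrow> a \<le> p x" for a x
    unfolding u_def by (rule cINF_greatest[OF C(1) that])
  show "sublinear u"
  proof (rule sublinearI)
    fix x y
    have *: "u (x + y) \<le> p x + q y" if pq: "p \<in> C" "q \<in> C" for p q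
    proof -
      obtain r where r: "r \<in> C" "r \<le> p" "r \<le> q" using chain[OF pq] pq by auto
      have "u (x + y) \<le> r x + r y"
        using le[OF r(1), of "x + y"] sublinear_add[OF C(2)[OF r(1)], of x y] by simp
      then show ?thesis using le_funD[OF r(2), of x] le_funD[OF r(3), of y] by linarith
    qed
    have "u (x + y) - u y \<le> u x"
    proof (rule greatest)
      fix p assume p: "p \<in> C"
      have "u (x + y) - p x \<le> u y"
        by (rule greatest) (use *[OF p] in \<open>auto simp: algebra_simps\<close>)
      then show "u (x + y) - u y \<le> p x" by simp
    qed
    then show "u (x + y) \<le> u x + u y" by simp
  next
    fix c :: real and x assume c: "c > 0"
    have "u (c *\<^sub>R x) / c \<le> u x"
    proof (rule greatest)
      fix p assume "p \<in> C"
      then show "u (c *\<^sub>R x) / c \<le> p x"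
        using le[of p "c *\<^sub>R x"] sublinear_scale[OF C(2), of p c x] c by (simp add: field_simps)
    qed
    then show "u (c *\<^sub>R x) \<le> c * u x" using c by (simp add: field_simps)
  next
    obtain p where "p \<in> C" using C(1) by auto
    then have "u 0 \<le> 0" using le[of p 0] sublinear_zero[OF C(2), of p] by simp
    moreover have "0 \<le> u 0" by (rule greatest) (simp add: sublinear_zero[OF C(2)])
    ultimately show "u 0 = 0" by simp
  qed
qed

text \<open>Hahn--Banach and Krein--Milman at once: a minimal sublinear functional whose linear
  minorants form a face is linear, and hence an extreme point.\<close>

theorem extreme_linear_below_sublinear:
  fixes p0 :: "'v::real_vector \<Rightarrow> real"
  assumes p0: "sublinear p0"
  obtains l where "linear l" "\<And>x. l x \<le> p0 x"
    "\<And>l1 l2 t. linear l1 \<Longrightarrow> linear l2 \<Longrightarrow> (\<And>x. l1 x \<le> p0 x) \<Longrightarrow> (\<And>x. l2 x \<le> p0 x) \<Longrightarrow>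
       0 < t \<Longrightarrow> t < 1 \<Longrightarrow> (\<And>x. l x = t * l1 x + (1 - t) * l2 x) \<Longrightarrow> l1 = l"
proof -
  \<comment> \<open>A sublinear functional stands for the set of its linear minorants, so a
    descending family of faces becomes a chain of functions and no topology on the dual space
    enters.\<close>
  define face where "face p \<longleftrightarrow> (\<forall>l1 l2 t. linear l1 \<and> linear l2 \<and> l1 \<le> p0 \<and> l2 \<le> p0 \<and>
    0 < t \<and> t < (1::real) \<and> (\<forall>x. t * l1 x + (1 - t) * l2 x \<le> p x) \<longrightarrow> l1 \<le> p \<and> l2 \<le> p)"
    for p :: "'v \<Rightarrow> real"
  define Q where "Q = {p. sublinear p \<and> p \<le> p0 \<and> face p}"
  have p0Q: "p0 \<in> Q" using p0 by (auto simp: Q_def face_def)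
  \<comment> \<open>The order is reversed: the Zorn-maximal element is a minimal functional.\<close>
  have "\<exists>m\<in>Q. \<forall>a\<in>Q. m \<ge> a \<longrightarrow> a = m"
  proof (rule predicate_Zorn)
    show "partial_order_on Q (relation_of (\<ge>) Q)"
      by (rule partial_order_on_relation_ofI) auto
  next
    fix C assume C: "C \<in> Chains (relation_of (\<ge>) Q)"
    have CQ: "C \<subseteq> Q" using C by (auto simp: Chains_def relation_of_def)
    have chain: "p \<le> q \<or> q \<le> p" if "p \<in> C" "q \<in> C" for p q
      using C that by (auto simp: Chains_def relation_of_def)
    show "\<exists>u\<in>Q. \<forall>a\<in>C. a \<ge> u"
    proof (cases "C = {}")
      case True then show ?thesis using p0Q by auto
    next
      case False
      let ?u = "\<lambda>x. INF p\<in>C. p x"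
      have u: "sublinear ?u" "\<And>p. p \<in> C \<Longrightarrow> ?u \<le> p"
        using sublinear_chain_Inf[OF False _ _ chain, of p0] CQ by (auto simp: Q_def)
      have "?u \<le> p0"
        using u(2) False CQ by (auto simp: Q_def intro: order_trans)
      moreover have "face ?u" unfolding face_def
      proof (intro allI impI, elim conjE)
        fix l1 l2 t assume l: "linear l1" "linear l2" "l1 \<le> p0" "l2 \<le> p0" "0 < t" "t < (1::real)"
          and le: "\<forall>x. t * l1 x + (1 - t) * l2 x \<le> ?u x"
        have "l1 \<le> p \<and> l2 \<le> p" if "p \<in> C" for p
        proof -
          have "face p" using that CQ by (auto simp: Q_def)
          moreover have "\<forall>x. t * l1 x + (1 - t) * l2 x \<le> p x"
            using le u(2)[OF that] by (auto simp: le_fun_def intro: order_trans)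
          ultimately show ?thesis using l unfolding face_def by blast
        qed
        then show "l1 \<le> ?u \<and> l2 \<le> ?u"
          using False by (auto simp: le_fun_def intro!: cINF_greatest)
      qed
      ultimately show ?thesis using u by (auto simp: Q_def)
    qed
  qed
  then obtain p where p: "p \<in> Q" and min: "\<And>a. a \<in> Q \<Longrightarrow> a \<le> p \<Longrightarrow> a = p" by auto
  have sub: "sublinear p" and pp0: "p \<le> p0" and fp: "face p" using p by (auto simp: Q_def)
  \<comment> \<open>Passing to the face at z stays inside \<open>Q\<close>, so minimality gives
    \<open>sublinear_face p z = p\<close> for every z; evaluated at -z this is oddness, and an odd
    sublinear functional is linear.\<close>
  have neg: "p (- z) = - p z" for z
  proof -
    let ?q = "sublinear_face p z"
    have qp: "?q \<le> p" using sublinear_face_le[OF sub, of 0 z] by (simp add: le_fun_def)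
    have "face ?q" unfolding face_def
    proof (intro allI impI, elim conjE)
      fix l1 l2 t assume l: "linear l1" "linear l2" "l1 \<le> p0" "l2 \<le> p0" "0 < t" "t < (1::real)"
        and le: "\<forall>x. t * l1 x + (1 - t) * l2 x \<le> ?q x"
      have lin: "linear (\<lambda>x. t * l1 x + (1 - t) * l2 x)"
        using linear_compose_add[OF linear_compose_scale_right[OF l(1), of t]
            linear_compose_scale_right[OF l(2), of "1 - t"]] by simp
      have *: "\<forall>x. t * l1 x + (1 - t) * l2 x \<le> p x" "t * l1 z + (1 - t) * l2 z = p z"
        using le linear_le_sublinear_face_iff[OF sub lin] by auto
      then have lp: "l1 \<le> p" "l2 \<le> p" using fp l unfolding face_def by blast+
      have "l1 z \<le> p z" "l2 z \<le> p z" using lp by (auto simp: le_fun_def)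
      \<comment> \<open>Both differences are nonnegative and carry positive weights, so a vanishing
        sum forces each of them to vanish.\<close>
      moreover have "t * (p z - l1 z) + (1 - t) * (p z - l2 z) = 0"
        using *(2) by (simp add: algebra_simps)
      ultimately have "t * (p z - l1 z) = 0" "(1 - t) * (p z - l2 z) = 0"
        using l(5,6) by (smt (verit) mult_nonneg_nonneg)+
      then have "l1 z = p z" "l2 z = p z" using l(5,6) by auto
      then show "l1 \<le> ?q \<and> l2 \<le> ?q"
        using linear_le_sublinear_face_iff[OF sub l(1), of z] linear_le_sublinear_face_iff[OF sub l(2), of z] lp
        by (auto simp: le_fun_def)
    qed
    then have "?q = p"
      using qp pp0 sublinear_sublinear_face[OF sub] by (intro min) (auto simp: Q_def)
    then have "p (- z) \<le> - p z"
      using sublinear_face_le[OF sub, of 1 z "- z"] sublinear_zero[OF sub] by simp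
    moreover have "- p z \<le> p (- z)" using sublinear_minus[OF sub, of "- z"] by simp
    ultimately show ?thesis by simp
  qed
  have lin: "linear p"
  proof (rule linearI)
    fix x y
    have "p (- x + - y) \<le> p (- x) + p (- y)" by (rule sublinear_add[OF sub])
    moreover have "p (- x + - y) = - p (x + y)" using neg[of "x + y"] by simp
    ultimately show "p (x + y) = p x + p y"
      using sublinear_add[OF sub, of x y] by (simp add: neg)
  next
    fix c :: real and x
    show "p (c *\<^sub>R x) = c *\<^sub>R p x"
    proof (cases "c \<ge> 0")
      case True then show ?thesis by (simp add: sublinear_scale[OF sub])
    next
      case False
      then show ?thesis using sublinear_scale[OF sub, of "- c" x] neg[of "c *\<^sub>R x"] by simp
    qed
  qed
  show thesis
  proof (rule that[OF lin])
    show "p x \<le> p0 x" for x using pp0 by (simp add: le_fun_def)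
    fix l1 l2 t assume l: "linear l1" "linear l2" "\<And>x. l1 x \<le> p0 x" "\<And>x. l2 x \<le> p0 x"
      "0 < t" "t < (1::real)" "\<And>x. p x = t * l1 x + (1 - t) * l2 x"
    then have "l1 \<le> p" using fp unfolding face_def le_fun_def by (metis order_refl)
    \<comment> \<open>A linear functional below a linear one coincides with it: compare at x and at
      -x.\<close>
    show "l1 = p"
    proof
      fix x
      show "l1 x = p x"
        using \<open>l1 \<le> p\<close>[THEN le_funD, of x] \<open>l1 \<le> p\<close>[THEN le_funD, of "- x"]
        by (simp add: linear_neg[OF l(1)] neg)
    qed
  qed
qed

section \<open>Riesz representation on compact metric spaces\<close>

text \<open>For finite z the truncated difference is adjoint to addition, which turns the claim into
  lower bounds for one infimum at a time.\<close>

lemma ennreal_le_INF_add_INF: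
  fixes a b :: "_ \<Rightarrow> ennreal"
  assumes "z < top" "\<And>i j. i \<in> I \<Longrightarrow> j \<in> J \<Longrightarrow> z \<le> a i + b j"
  shows "z \<le> (INF i\<in>I. a i) + (INF j\<in>J. b j)"
proof -
  have iff: "z - x \<le> y \<longleftrightarrow> z \<le> x + y" for x y :: ennreal
    using assms(1) by (auto simp: ennreal_minus_le_iff)
  have "z \<le> a i + (INF j\<in>J. b j)" if "i \<in> I" for i
    using assms(2)[OF that] by (auto simp: iff[symmetric] intro!: INF_greatest)
  then have "z - (INF j\<in>J. b j) \<le> (INF i\<in>I. a i)"
    by (intro INF_greatest) (simp add: iff add.commute)
  then show ?thesis by (simp add: iff add.commute)
qed

text \<open>\<open>L\<close> is total on real functions, but its laws are demanded on continuous
  ones only; elsewhere its values are arbitrary.\<close>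

locale prob_functional =
  fixes L :: "('m::metric_space \<Rightarrow> real) \<Rightarrow> real"
  assumes add: "continuous_on UNIV g \<Longrightarrow> continuous_on UNIV h \<Longrightarrow> L (\<lambda>x. g x + h x) = L g + L h"
    and scale: "continuous_on UNIV g \<Longrightarrow> L (\<lambda>x. c * g x) = c * L g"
    and nonneg: "continuous_on UNIV g \<Longrightarrow> (\<And>x. g x \<ge> 0) \<Longrightarrow> L g \<ge> 0"
    and one: "L (\<lambda>_. 1) = 1"
begin

lemma const: "L (\<lambda>_. c) = c"
  using scale[of "\<lambda>_. 1" c] one by simp

lemma diff:
  assumes "continuous_on UNIV g" "continuous_on UNIV h"
  shows "L (\<lambda>x. g x - h x) = L g - L h"
  using add[OF assms(1) continuous_on_minus[OF assms(2)]] scale[OF assms(2), of "-1"] by simp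

lemma mono:
  assumes "continuous_on UNIV g" "continuous_on UNIV h" "\<And>x. g x \<le> h x"
  shows "L g \<le> L h"
  using nonneg[OF continuous_on_diff[OF assms(2,1)]] diff[OF assms(2,1)] assms(3) by simp

lemma sum:
  assumes "finite I" "\<And>i. i \<in> I \<Longrightarrow> continuous_on UNIV (g i)"
  shows "L (\<lambda>x. \<Sum>i\<in>I. g i x) = (\<Sum>i\<in>I. L (g i))"
  using assms
proof (induction I rule: finite_induct)
  case empty
  then show ?case using const[of 0] by simp
next
  case (insert i I)
  then have "L (\<lambda>x. g i x + (\<Sum>i\<in>I. g i x)) = L (g i) + L (\<lambda>x. \<Sum>i\<in>I. g i x)"
    by (intro add continuous_on_sum) auto
  with insert show ?case by simp
qed

section \<open>Contents of closed and open sets induced by a positive functional\<close>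

definition content :: "'m set \<Rightarrow> ennreal" where
  "content K = (INF g\<in>{g. continuous_on UNIV g \<and> (\<forall>x. indicator K x \<le> g x)}. ennreal (L g))"

text \<open>Closed sets take the role of compact sets, with which they coincide once the whole space
  is compact. Open sets are measured from inside here and arbitrary sets from outside below, so
  regularity is built in.\<close>

definition inner_content :: "'m set \<Rightarrow> ennreal" where
  "inner_content U = (SUP K\<in>{K. closed K \<and> K \<subseteq> U}. content K)"

definition outer_content :: "'m set \<Rightarrow> ennreal" where
  "outer_content A = (INF U\<in>{U. open U \<and> A \<subseteq> U}. inner_content U)"

lemma content_le:
  assumes "continuous_on UNIV g" "\<And>x. indicator K x \<le> g x"
  shows "content K \<le> ennreal (L g)"
  unfolding content_def by (rule INF_lower) (use assms in auto)

lemma indicator_le_imp_nonneg: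
  assumes "indicator K x \<le> (g :: real)" shows "g \<ge> 0"
  using assms by (meson indicator_pos_le order_trans)

lemma content_le_1: "content K \<le> 1"
  using content_le[of "\<lambda>_. 1" K] one by (simp add: indicator_le_1)

lemma content_Un_le: "content (K \<union> K') \<le> content K + content K'"
  unfolding content_def[of K] content_def[of K']
proof (rule ennreal_le_INF_add_INF)
  show "content (K \<union> K') < top"
    by (rule le_less_trans[OF content_le_1]) simp
  fix g h :: "'m \<Rightarrow> real" assume "g \<in> {g. continuous_on UNIV g \<and> (\<forall>x. indicator K x \<le> g x)}"
    "h \<in> {g. continuous_on UNIV g \<and> (\<forall>x. indicator K' x \<le> g x)}"
  then have gh: "continuous_on UNIV g" "continuous_on UNIV h"
    "\<And>x. indicator K x \<le> g x" "\<And>x. indicator K' x \<le> h x" by auto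
  have nn: "g x \<ge> 0" "h x \<ge> 0" for x
    by (rule indicator_le_imp_nonneg[OF gh(3)], rule indicator_le_imp_nonneg[OF gh(4)])
  have "content (K \<union> K') \<le> ennreal (L (\<lambda>x. g x + h x))"
  proof (rule content_le)
    show "continuous_on UNIV (\<lambda>x. g x + h x)" using gh by (auto intro: continuous_on_add)
    fix x
    have "indicator (K \<union> K') x \<le> (indicator K x + indicator K' x :: real)"
      by (auto simp: indicator_def)
    also have "\<dots> \<le> g x + h x" using gh by (auto intro: add_mono)
    finally show "indicator (K \<union> K') x \<le> g x + h x" .
  qed
  also have "\<dots> = ennreal (L g) + ennreal (L h)"
    using gh nn by (simp add: add nonneg ennreal_plus)
  finally show "content (K \<union> K') \<le> ennreal (L g) + ennreal (L h)" .
qed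

text \<open>Urysohn's function as a quotient of distances. Empty sets are treated apart because
  \<open>infdist\<close> to the empty set is 0.\<close>

lemma continuous_separation:
  fixes K K' :: "'m set"
  assumes "closed K" "closed K'" "K \<inter> K' = {}"
  obtains w :: "'m \<Rightarrow> real" where "continuous_on UNIV w" "\<And>x. 0 \<le> w x" "\<And>x. w x \<le> 1"
    "\<And>x. x \<in> K \<Longrightarrow> w x = 1" "\<And>x. x \<in> K' \<Longrightarrow> w x = 0"
proof (cases "K = {} \<or> K' = {}")
  case True
  then show thesis
    using that[of "\<lambda>_. 0"] that[of "\<lambda>_. 1"] by (cases "K = {}") auto
next
  case False
  have pos: "infdist x K + infdist x K' > 0" for x
  proof -
    have "infdist x K \<noteq> 0 \<or> infdist x K' \<noteq> 0"
      using assms False in_closed_iff_infdist_zero[of K x] in_closed_iff_infdist_zero[of K' x] by auto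
    then show ?thesis using infdist_nonneg[of x K] infdist_nonneg[of x K'] by linarith
  qed
  let ?w = "\<lambda>x. infdist x K' / (infdist x K + infdist x K')"
  show thesis
  proof (rule that[of ?w])
    show "continuous_on UNIV ?w"
      using pos by (intro continuous_intros ballI) (smt (verit))
    show "0 \<le> ?w x" "?w x \<le> 1" for x
      using pos[of x] infdist_nonneg[of x K] infdist_nonneg[of x K'] by (auto simp: field_simps)
    show "?w x = 1" if "x \<in> K" for x using that pos[of x] by simp
    show "?w x = 0" if "x \<in> K'" for x using that by simp
  qed
qed

text \<open>A function g dominating the indicator of the union splits as g w + g (1 - w) with a
  separating function w, and each summand dominates one of the two indicators.\<close>

lemma content_Un_ge:
  assumes "closed K" "closed K'" "K \<inter> K' = {}"
  shows "content K + content K' \<le> content (K \<union> K')"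
  unfolding content_def[of "K \<union> K'"]
proof (rule INF_greatest, safe)
  fix g :: "'m \<Rightarrow> real" assume g: "continuous_on UNIV g" "\<forall>x. indicator (K \<union> K') x \<le> g x"
  obtain w :: "'m \<Rightarrow> real" where w: "continuous_on UNIV w" "\<And>x. 0 \<le> w x" "\<And>x. w x \<le> 1"
    "\<And>x. x \<in> K \<Longrightarrow> w x = 1" "\<And>x. x \<in> K' \<Longrightarrow> w x = 0"
    by (rule continuous_separation[OF assms]) (rule that)
  have nn: "g x \<ge> 0" for x by (rule indicator_le_imp_nonneg[OF g(2)[rule_format]])
  have ge: "1 \<le> g x" if "x \<in> K \<union> K'" for x using g(2)[rule_format, of x] that by simp
  have cont: "continuous_on UNIV (\<lambda>x. g x * w x)" "continuous_on UNIV (\<lambda>x. g x * (1 - w x))"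
    using g(1) w(1) by (auto intro!: continuous_intros)
  have "content K \<le> ennreal (L (\<lambda>x. g x * w x))"
    using cont(1) ge nn w by (intro content_le) (auto simp: indicator_def)
  moreover have "content K' \<le> ennreal (L (\<lambda>x. g x * (1 - w x)))"
    using cont(2) ge nn w by (intro content_le) (auto simp: indicator_def)
  ultimately have "content K + content K' \<le> ennreal (L (\<lambda>x. g x * w x)) + ennreal (L (\<lambda>x. g x * (1 - w x)))"
    by (rule add_mono)
  also have "\<dots> = ennreal (L (\<lambda>x. g x * w x) + L (\<lambda>x. g x * (1 - w x)))"
    using nn w(2,3) cont by (intro ennreal_plus[symmetric] nonneg) auto
  also have "L (\<lambda>x. g x * w x) + L (\<lambda>x. g x * (1 - w x)) = L g"
    using add[OF cont] by (simp add: algebra_simps)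
  finally show "content K + content K' \<le> ennreal (L g)" .
qed

lemma content_mono: "K \<subseteq> K' \<Longrightarrow> content K \<le> content K'"
  unfolding content_def
  by (rule INF_superset_mono) (auto simp: indicator_def split: if_splits intro: order_trans[OF zero_le_one])

lemma content_le_inner: "closed K \<Longrightarrow> K \<subseteq> U \<Longrightarrow> content K \<le> inner_content U"
  unfolding inner_content_def by (rule SUP_upper) auto

lemma inner_content_mono: "U \<subseteq> V \<Longrightarrow> inner_content U \<le> inner_content V"
  unfolding inner_content_def by (rule SUP_subset_mono) auto

lemma inner_content_le:
  assumes "continuous_on UNIV g" "\<And>x. indicator U x \<le> g x"
  shows "inner_content U \<le> ennreal (L g)"
  unfolding inner_content_def
proof (rule SUP_least, safe)
  fix K assume "K \<subseteq> U"
  then have "content K \<le> content U" by (rule content_mono)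
  with content_le[OF assms] show "content K \<le> ennreal (L g)" by simp
qed

lemma content_empty: "content {} = 0"
  using content_le[of "\<lambda>_. 0" "{}"] const[of 0] by simp

lemma inner_content_UNIV: "inner_content UNIV = 1"
proof (rule antisym)
  show "inner_content UNIV \<le> 1" using inner_content_le[of "\<lambda>_. 1" UNIV] one by simp
  have "1 \<le> content UNIV" unfolding content_def
  proof (rule INF_greatest, safe)
    fix g :: "'m \<Rightarrow> real" assume "continuous_on UNIV g" "\<forall>x. indicator UNIV x \<le> g x"
    then show "1 \<le> ennreal (L g)" using mono[of "\<lambda>_. 1" g] one by simp
  qed
  also have "\<dots> \<le> inner_content UNIV" by (rule content_le_inner) auto
  finally show "1 \<le> inner_content UNIV" .
qed

text \<open>A point of \<open>K\<close> goes to the open set whose complement is farther away; as it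
  lies in one of the two sets, the larger distance is positive. A set equal to \<open>UNIV\<close>
  is treated apart because its complement is empty and \<open>infdist\<close> is 0 there.\<close>

lemma closed_split_Un:
  fixes K :: "'m set"
  assumes K: "closed K" "K \<subseteq> U \<union> V" and op: "open U" "open V"
  obtains K1 K2 where "closed K1" "closed K2" "K1 \<subseteq> U" "K2 \<subseteq> V" "K = K1 \<union> K2"
proof (cases "U = UNIV \<or> V = UNIV")
  case True
  then show thesis using that[of K "{}"] that[of "{}" K] K by auto
next
  case False
  have iff: "x \<in> U \<longleftrightarrow> infdist x (- U) \<noteq> 0" "x \<in> V \<longleftrightarrow> infdist x (- V) \<noteq> 0" for x
    using False op in_closed_iff_infdist_zero[of "- U" x] in_closed_iff_infdist_zero[of "- V" x] by auto
  let ?K1 = "K \<inter> {x. infdist x (- V) \<le> infdist x (- U)}"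
  let ?K2 = "K \<inter> {x. infdist x (- U) \<le> infdist x (- V)}"
  show thesis
  proof (rule that[of ?K1 ?K2])
    show "closed ?K1" "closed ?K2"
      using K(1) by (intro closed_Int closed_Collect_le continuous_intros; simp)+
    show "?K1 \<subseteq> U"
    proof
      fix x assume x: "x \<in> ?K1"
      then have "x \<in> U \<or> x \<in> V" using K(2) by auto
      then show "x \<in> U" using x infdist_nonneg[of x "- V"] iff[of x] by auto
    qed
    show "?K2 \<subseteq> V"
    proof
      fix x assume x: "x \<in> ?K2"
      then have "x \<in> U \<or> x \<in> V" using K(2) by auto
      then show "x \<in> V" using x infdist_nonneg[of x "- U"] iff[of x] by auto
    qed
  qed auto
qed

lemma inner_content_Un_le:
  assumes "open U" "open V"
  shows "inner_content (U \<union> V) \<le> inner_content U + inner_content V"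
  unfolding inner_content_def[of "U \<union> V"]
proof (rule SUP_least, safe)
  fix K assume "closed K" "K \<subseteq> U \<union> V"
  then obtain K1 K2 where K: "closed K1" "closed K2" "K1 \<subseteq> U" "K2 \<subseteq> V" "K = K1 \<union> K2"
    using closed_split_Un assms by metis
  have "content K \<le> content K1 + content K2" unfolding K(5) by (rule content_Un_le)
  also have "\<dots> \<le> inner_content U + inner_content V"
    using K by (intro add_mono content_le_inner)
  finally show "content K \<le> inner_content U + inner_content V" .
qed

lemma inner_content_empty: "inner_content {} = 0"
  using content_empty by (simp add: inner_content_def)

lemma inner_content_UN_le:
  assumes "\<And>i::nat. open (U i)"
  shows "inner_content (\<Union>i<n. U i) \<le> (\<Sum>i<n. inner_content (U i))"
proof (induction n)
  case 0 then show ?case by (simp add: inner_content_empty)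
next
  case (Suc n)
  have "inner_content ((\<Union>i<n. U i) \<union> U n) \<le> inner_content (\<Union>i<n. U i) + inner_content (U n)"
    by (rule inner_content_Un_le) (use assms in auto)
  also have "\<dots> \<le> (\<Sum>i<n. inner_content (U i)) + inner_content (U n)"
    using Suc by (rule add_right_mono)
  finally show ?case by (simp add: lessThan_Suc Un_commute add.commute)
qed

text \<open>Compactness enters here: a closed subset of the union is covered by finitely many of the
  open sets.\<close>

lemma inner_content_countably_subadditive:
  assumes compact: "compact (UNIV :: 'm set)" and U: "\<And>i::nat. open (U i)"
  shows "inner_content (\<Union>i. U i) \<le> (\<Sum>i. inner_content (U i))"
  unfolding inner_content_def[of "\<Union>i. U i"]
proof (rule SUP_least, safe)
  fix K assume K: "closed K" "K \<subseteq> (\<Union>i. U i)"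
  have "compact K" using compact_Int_closed[OF compact K(1)] by simp
  then obtain C where C: "finite C" "K \<subseteq> (\<Union>i\<in>C. U i)"
    using compactE_image[of K UNIV U] U K(2) by metis
  obtain n where n: "C \<subseteq> {..<n}" using C(1) by (auto simp: finite_nat_iff_bounded)
  have "content K \<le> inner_content (\<Union>i<n. U i)"
    using C(2) n by (intro content_le_inner K(1)) blast
  also have "\<dots> \<le> (\<Sum>i<n. inner_content (U i))" using U by (rule inner_content_UN_le)
  also have "\<dots> \<le> (\<Sum>i. inner_content (U i))" by (rule sum_le_suminf) auto
  finally show "content K \<le> (\<Sum>i. inner_content (U i))" .
qed

lemma outer_content_le: "open U \<Longrightarrow> A \<subseteq> U \<Longrightarrow> outer_content A \<le> inner_content U"
  unfolding outer_content_def by (rule INF_lower) auto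

lemma outer_content_open: "open U \<Longrightarrow> outer_content U = inner_content U"
  by (rule antisym[OF outer_content_le]) (auto simp: outer_content_def intro!: INF_greatest inner_content_mono)

lemma outer_content_le_1: "outer_content A \<le> 1"
  using outer_content_le[of UNIV A] inner_content_UNIV by simp

section \<open>The outer measure and its measurable sets\<close>

lemma outer_measure_space_outer_content:
  assumes compact: "compact (UNIV :: 'm set)"
  shows "outer_measure_space (Pow UNIV) outer_content"
  unfolding outer_measure_space_def
proof (intro conjI)
  show "positive (Pow UNIV) outer_content"
    using outer_content_open[of "{}"] inner_content_empty by (simp add: positive_def)
  show "increasing (Pow UNIV) outer_content"
    unfolding increasing_def outer_content_def by (auto intro!: INF_superset_mono)
  show "countably_subadditive (Pow UNIV) outer_content"
    unfolding countably_subadditive_def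
  proof (intro allI impI)
    fix A :: "nat \<Rightarrow> 'm set"
    show "outer_content (\<Union>i. A i) \<le> (\<Sum>i. outer_content (A i))"
    proof (rule ennreal_le_epsilon)
      fix e :: real assume e: "0 < e"
      have sums: "(\<lambda>i. e * (1/2) ^ Suc i) sums e"
        using sums_mult[OF power_half_series, of e] by (simp only: mult_1_right)
      have "\<exists>U. open U \<and> A i \<subseteq> U \<and> inner_content U \<le> outer_content (A i) + ennreal (e * (1/2) ^ Suc i)" for i
      proof -
        have "outer_content (A i) < outer_content (A i) + ennreal (e * (1/2) ^ Suc i)"
          using le_less_trans[OF outer_content_le_1[of "A i"], of top] e by auto
        then show ?thesis
          unfolding outer_content_def INF_less_iff by (auto intro: less_imp_le)
      qed
      then obtain U where U: "\<And>i. open (U i)" "\<And>i. A i \<subseteq> U i"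
        "\<And>i. inner_content (U i) \<le> outer_content (A i) + ennreal (e * (1/2) ^ Suc i)" by metis
      have "outer_content (\<Union>i. A i) \<le> inner_content (\<Union>i. U i)"
        using U by (intro outer_content_le) auto
      also have "\<dots> \<le> (\<Sum>i. inner_content (U i))"
        using compact U(1) by (rule inner_content_countably_subadditive)
      also have "\<dots> \<le> (\<Sum>i. outer_content (A i) + ennreal (e * (1/2) ^ Suc i))"
        using U(3) by (intro suminf_le) auto
      also have "\<dots> = (\<Sum>i. outer_content (A i)) + (\<Sum>i. ennreal (e * (1/2) ^ Suc i))"
        by (intro suminf_add[symmetric]) auto
      also have "(\<Sum>i. ennreal (e * (1/2) ^ Suc i)) = ennreal e"
        by (rule suminf_ennreal_eq[OF _ sums]) (use e in auto)
      finally show "outer_content (\<Union>i. A i) \<le> (\<Sum>i. outer_content (A i)) + ennreal e" .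
    qed
  qed
qed

text \<open>Caratheodory's inequality, tested on an open W containing A. A closed K inside both W
  and U leaves A - U inside the open set W - K; any closed set there is disjoint from K, so the
  contents add up inside W. Taking suprema, first over the second closed set and then over K, gives
  the claim.\<close>

lemma outer_content_measurable:
  assumes U: "open U"
  shows "outer_content (A \<inter> U) + outer_content (A - U) \<le> outer_content A"
  unfolding outer_content_def[of A]
proof (rule INF_greatest, safe)
  fix W assume W: "open W" "A \<subseteq> W"
  have "content K + outer_content (A - U) \<le> inner_content W" if K: "closed K" "K \<subseteq> W \<inter> U" for K
  proof -
    have "outer_content (A - U) \<le> inner_content (W - K)"
      using W K by (intro outer_content_le open_Diff) auto
    then have "content K + outer_content (A - U) \<le> content K + inner_content (W - K)"
      by (rule add_left_mono)
    also have "\<dots> = (SUP K'\<in>{K'. closed K' \<and> K' \<subseteq> W - K}. content K + content K')"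
      unfolding inner_content_def by (rule ennreal_SUP_add_right) auto
    also have "\<dots> \<le> inner_content W"
    proof (rule SUP_least, safe)
      fix K' assume K': "closed K'" "K' \<subseteq> W - K"
      have "content K + content K' \<le> content (K \<union> K')"
        using K K' by (intro content_Un_ge) auto
      also have "\<dots> \<le> inner_content W"
        using K K' by (intro content_le_inner) auto
      finally show "content K + content K' \<le> inner_content W" .
    qed
    finally show ?thesis .
  qed
  then have "(SUP K\<in>{K. closed K \<and> K \<subseteq> W \<inter> U}. outer_content (A - U) + content K) \<le> inner_content W"
    by (intro SUP_least) (auto simp: add.commute)
  also have "(SUP K\<in>{K. closed K \<and> K \<subseteq> W \<inter> U}. outer_content (A - U) + content K)
      = outer_content (A - U) + inner_content (W \<inter> U)"
    unfolding inner_content_def by (rule ennreal_SUP_add_right[symmetric]) auto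
  finally have "outer_content (A - U) + inner_content (W \<inter> U) \<le> inner_content W" .
  moreover have "outer_content (A \<inter> U) \<le> inner_content (W \<inter> U)"
    using W U by (intro outer_content_le) auto
  ultimately show "outer_content (A \<inter> U) + outer_content (A - U) \<le> inner_content W"
    by (metis add.commute add_left_mono order_trans)
qed

lemma borel_subset_lambda_system:
  assumes compact: "compact (UNIV :: 'm set)"
  shows "sets borel \<subseteq> lambda_system UNIV (Pow UNIV) outer_content"
proof -
  note oms = outer_measure_space_outer_content[OF compact]
  interpret S: sigma_algebra UNIV "Pow UNIV :: 'm set set" by (rule sigma_algebra_Pow)
  have sa: "sigma_algebra UNIV (lambda_system UNIV (Pow UNIV) outer_content)"
    using S.caratheodory_lemma[OF oms] by (simp add: measure_space_def)
  have sub: "outer_content (A \<union> B) \<le> outer_content A + outer_content B" for A B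
  proof -
    have "countably_subadditive (Pow UNIV) outer_content" "positive (Pow UNIV) outer_content"
      using oms by (auto simp: outer_measure_space_def)
    then have "subadditive (Pow UNIV) outer_content"
      by (intro ring_of_sets.countably_subadditive_subadditive) unfold_locales
    then show ?thesis unfolding subadditive_def
    proof -
      assume *: "\<forall>x\<in>Pow UNIV. \<forall>y\<in>Pow UNIV. x \<inter> y = {} \<longrightarrow> outer_content (x \<union> y) \<le> outer_content x + outer_content y"
      \<comment> \<open>\<open>subadditive\<close> speaks of disjoint sets only, hence the detour
        through B - A.\<close>
      have "outer_content (A \<union> (B - A)) \<le> outer_content A + outer_content (B - A)"
        using *[rule_format, of A "B - A"] by auto
      also have "\<dots> \<le> outer_content A + outer_content B"
        using oms by (intro add_left_mono) (auto simp: outer_measure_space_def increasing_def)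
      finally show ?thesis by simp
    qed
  qed
  have "{U. open U} \<subseteq> lambda_system UNIV (Pow UNIV) outer_content"
  proof safe
    fix U :: "'m set" assume U: "open U"
    have "outer_content (A \<inter> U) + outer_content (A - U) = outer_content A" for A
      using sub[of "A \<inter> U" "A - U"] outer_content_measurable[OF U, of A]
      by (intro antisym) (auto simp: Int_Diff_Un)
    then show "U \<in> lambda_system UNIV (Pow UNIV) outer_content"
      unfolding S.lambda_system_eq by simp
  qed
  then show ?thesis
    unfolding borel_def using sigma_algebra.sigma_sets_subset[OF sa] by (simp add: sets_measure_of)
qed

section \<open>The representing measure and its integrals\<close>

lemma sum_clamp:
  fixes y :: real assumes "y \<ge> 0"
  shows "(\<Sum>k<n. min 1 (max 0 (y - real k))) = min y (real n)"
  using assms by (induction n) auto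

theorem riesz_representation:
  assumes compact: "compact (UNIV :: 'm set)"
  obtains \<mu> where "prob_space \<mu>" "sets \<mu> = sets borel"
    "\<And>g. continuous_on UNIV g \<Longrightarrow> integral\<^sup>L \<mu> g = L g"
proof -
  interpret S: sigma_algebra UNIV "Pow UNIV :: 'm set set" by (rule sigma_algebra_Pow)
  define \<mu> where "\<mu> = measure_of UNIV (sets (borel :: 'm measure)) outer_content"
  have ms: "measure_space UNIV (sets borel) outer_content"
    using S.caratheodory_lemma[OF outer_measure_space_outer_content[OF compact]]
      borel_subset_lambda_system[OF compact] sets.sigma_algebra_axioms[of borel]
    by (auto intro: measure_down)
  have sets: "sets \<mu> = sets borel"
    unfolding \<mu>_def using sets.sets_measure_of_eq[of "borel :: 'm measure"] by simp
  have em: "emeasure \<mu> A = outer_content A" if "A \<in> sets borel" for A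
    unfolding \<mu>_def using ms that sets.sigma_algebra_axioms[of "borel :: 'm measure"]
    by (intro emeasure_measure_of_sigma) (auto simp: measure_space_def)
  have sp: "space \<mu> = UNIV" using sets_eq_imp_space_eq[OF sets] by simp
  have prob: "prob_space \<mu>"
    by (rule prob_spaceI) (simp add: sp em outer_content_open inner_content_UNIV)
  interpret prob_space \<mu> by (rule prob)
  have meas: "g \<in> borel_measurable \<mu>" if "continuous_on UNIV g" for g :: "'m \<Rightarrow> real"
    using borel_measurable_continuous_onI[OF that] measurable_cong_sets[OF sets refl] by auto
  have int: "integrable \<mu> g" if g: "continuous_on UNIV g" for g :: "'m \<Rightarrow> real"
  proof -
    obtain B where "\<And>x. norm (g x) \<le> B"
      using compact_imp_bounded[OF compact_continuous_image[OF g compact]]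
      by (auto simp: bounded_iff)
    then show ?thesis using meas[OF g] by (intro integrable_const_bound) auto
  qed
  \<comment> \<open>Layer-cake argument: \<open>?n * g\<close> is cut into continuous slices \<psi>
    of height one. The indicator of \<open>U k\<close> lies below slice k and above slice k + 1, so
    measures of open sets compare the integral with \<open>L\<close>; the index shift loses only the
    bottom slice, an error of 1 before division by \<open>?n\<close>.\<close>
  have upper: "integral\<^sup>L \<mu> g \<le> L g" if g: "continuous_on UNIV g" "\<And>x. 0 \<le> g x" "\<And>x. g x \<le> 1" for g
  proof -
    have "integral\<^sup>L \<mu> g \<le> L g + 1 / real (Suc n)" for n
    proof -
      let ?n = "real (Suc n)"
      define \<psi> where "\<psi> k x = min 1 (max 0 (?n * g x - real k))" for k x
      have c\<psi>: "continuous_on UNIV (\<psi> k)" for k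
        unfolding \<psi>_def using g(1) by (intro continuous_intros)
      have nn: "0 \<le> \<psi> k x" for k x by (simp add: \<psi>_def)
      have sum\<psi>: "(\<Sum>k<Suc n. \<psi> k x) = ?n * g x" for x
      proof -
        have "?n * g x \<le> ?n" using g(2,3)[of x] by (simp add: mult_left_le)
        then show ?thesis using g(2)[of x] unfolding \<psi>_def by (subst sum_clamp) auto
      qed
      define U where "U k = {x. real (Suc k) < ?n * g x}" for k
      have oU: "open (U k)" for k
        unfolding U_def using g(1) by (intro open_Collect_less continuous_intros)
      have sU: "U k \<in> sets \<mu>" for k using oU sets by auto
      have m: "measure \<mu> (U k) \<le> L (\<psi> k)" for k
      proof -
        have "emeasure \<mu> (U k) \<le> ennreal (L (\<psi> k))"
          using oU[of k] nn[of k] c\<psi>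
          by (subst em, simp, subst outer_content_open)
             (auto intro!: inner_content_le simp: indicator_def U_def \<psi>_def)
        then show ?thesis
          using nonneg[OF c\<psi> nn, of k] by (simp add: emeasure_eq_measure)
      qed
      have iU: "integrable \<mu> (indicator (U k) :: 'm \<Rightarrow> real)" for k
        using sU by (intro integrable_real_indicator) (auto simp: emeasure_eq_measure)
      have le: "?n * g x \<le> 1 + (\<Sum>k<n. indicator (U k) x)" for x
      proof -
        have "?n * g x = \<psi> 0 x + (\<Sum>k<n. \<psi> (Suc k) x)"
          unfolding sum\<psi>[of x, symmetric] by (rule sum.lessThan_Suc_shift)
        also have "\<dots> \<le> 1 + (\<Sum>k<n. indicator (U k) x)"
          by (intro add_mono sum_mono) (auto simp: \<psi>_def U_def indicator_def)
        finally show ?thesis .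
      qed
      have "?n * integral\<^sup>L \<mu> g = integral\<^sup>L \<mu> (\<lambda>x. ?n * g x)" by simp
      also have "\<dots> \<le> integral\<^sup>L \<mu> (\<lambda>x. 1 + (\<Sum>k<n. indicator (U k) x))"
        using le int[OF g(1)] iU
        by (intro integral_mono integrable_mult_right Bochner_Integration.integrable_add
            Bochner_Integration.integrable_sum) auto
      also have "\<dots> = 1 + (\<Sum>k<n. measure \<mu> (U k))"
        using iU by (simp add: Bochner_Integration.integral_add Bochner_Integration.integral_sum sp prob_space[unfolded sp])
      also have "\<dots> \<le> 1 + (\<Sum>k<Suc n. L (\<psi> k))"
        using sum_mono[of "{..<n}" "\<lambda>k. measure \<mu> (U k)" "\<lambda>k. L (\<psi> k)", OF m] nonneg[OF c\<psi> nn, of n] by simp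
      also have "(\<Sum>k<Suc n. L (\<psi> k)) = ?n * L g"
        using sum[of "{..<Suc n}" \<psi>, OF _ c\<psi>] by (simp only: sum\<psi> scale[OF g(1)] finite_lessThan)
      finally show ?thesis by (simp add: field_simps)
    qed
    then have "(\<lambda>n. L g + 1 / real (Suc n)) \<longlonglongrightarrow> L g + 0 \<Longrightarrow> ?thesis"
      by (intro LIMSEQ_le_const[of "\<lambda>n. L g + 1 / real (Suc n)" "L g"]) auto
    moreover have "(\<lambda>n. L g + 1 / real (Suc n)) \<longlonglongrightarrow> L g + 0"
      using LIMSEQ_inverse_real_of_nat by (intro tendsto_add) (auto simp: inverse_eq_divide)
    ultimately show ?thesis by blast
  qed
  \<comment> \<open>The upper bound for 1 - g is the lower bound for g.\<close>
  have eq01: "integral\<^sup>L \<mu> g = L g" if g: "continuous_on UNIV g" "\<And>x. 0 \<le> g x" "\<And>x. g x \<le> 1" for g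
  proof (rule antisym[OF upper[OF g]])
    have "integral\<^sup>L \<mu> (\<lambda>x. 1 - g x) \<le> L (\<lambda>x. 1 - g x)"
      using g by (intro upper continuous_intros) auto
    then show "L g \<le> integral\<^sup>L \<mu> g"
      using int[OF g(1)] by (simp add: diff g(1) one prob_space)
  qed
  have eq: "integral\<^sup>L \<mu> g = L g" if g: "continuous_on UNIV g" for g
  proof -
    obtain B where B: "\<And>x. norm (g x) \<le> B"
      using compact_imp_bounded[OF compact_continuous_image[OF g compact]]
      by (auto simp: bounded_iff)
    define b where "b = max B 1"
    have b: "b > 0" "\<bar>g x\<bar> \<le> b" for x using B[of x] by (auto simp: b_def)
    \<comment> \<open>The affine change of g that brings its values from [-b, b] to [0, 1].\<close>
    let ?h = "\<lambda>x. (1 / (2 * b)) * (g x + b)"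
    have h: "continuous_on UNIV ?h" "0 \<le> ?h x" "?h x \<le> 1" for x
      using g b(1) b(2)[of x] by (auto intro!: continuous_intros simp: divide_simps abs_le_iff)
    have "integral\<^sup>L \<mu> ?h = L ?h" by (rule eq01[OF h])
    moreover have "L ?h = (1 / (2 * b)) * (L g + b)"
      using scale[of "\<lambda>x. g x + b" "1 / (2 * b)"] add[OF g, of "\<lambda>_. b"] const[of b] g
      by (simp add: continuous_on_add)
    moreover have "integral\<^sup>L \<mu> ?h = (1 / (2 * b)) * (integral\<^sup>L \<mu> g + b)"
      using int[OF g] by (simp add: prob_space)
    ultimately show ?thesis using b(1) by simp
  qed
  show thesis by (rule that[OF prob sets eq])
qed

end

text \<open>Indicators of nonempty closed sets are pointwise limits of continuous functions of the
  distance, and the closed sets form an intersection-stable generator of the Borel sets.\<close>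

lemma prob_measure_eqI_continuous:
  fixes \<mu> \<nu> :: "'m::metric_space measure"
  assumes \<mu>: "prob_space \<mu>" "sets \<mu> = sets borel" and \<nu>: "prob_space \<nu>" "sets \<nu> = sets borel"
    and eq: "\<And>g :: 'm \<Rightarrow> real. continuous_on UNIV g \<Longrightarrow> integral\<^sup>L \<mu> g = integral\<^sup>L \<nu> g"
  shows "\<mu> = \<nu>"
proof -
  interpret \<mu>: prob_space \<mu> by fact
  interpret \<nu>: prob_space \<nu> by fact
  have sp: "space \<mu> = UNIV" "space \<nu> = UNIV"
    using sets_eq_imp_space_eq[OF \<mu>(2)] sets_eq_imp_space_eq[OF \<nu>(2)] by auto
  have closed_eq: "emeasure \<mu> K = emeasure \<nu> K" if K: "closed K" for K
  proof (cases "K = {}")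
    case False
    define g where "g n x = max 0 (1 - real n * infdist x K)" for n x
    have cg: "continuous_on UNIV (g n)" for n
      unfolding g_def by (intro continuous_intros)
    have lim: "(\<lambda>n. g n x) \<longlonglongrightarrow> indicator K x" for x
    proof (cases "x \<in> K")
      case True then show ?thesis by (simp add: g_def)
    next
      case x: False
      then have pos: "infdist x K > 0"
        using in_closed_iff_infdist_zero[OF K False, of x] infdist_nonneg[of x K] by linarith
      obtain N where N: "1 < real N * infdist x K"
        using reals_Archimedean3[OF pos] by blast
      have "g n x = 0" if "n \<ge> N" for n
      proof -
        have "real N * infdist x K \<le> real n * infdist x K"
          using that pos by (intro mult_right_mono) auto
        then show ?thesis using N by (simp add: g_def)
      qed
      then show ?thesis using x
        by (intro tendsto_eventually eventually_sequentiallyI[of N]) auto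
    qed
    have conv: "(\<lambda>n. integral\<^sup>L M (g n)) \<longlonglongrightarrow> measure M K"
      if M: "prob_space M" "sets M = sets borel" for M
    proof -
      interpret prob_space M by fact
      have "(\<lambda>n. integral\<^sup>L M (g n)) \<longlonglongrightarrow> integral\<^sup>L M (indicator K)"
      proof (rule integral_dominated_convergence[where w = "\<lambda>_. 1"])
        show "indicator K \<in> borel_measurable M"
          using K M(2) by (intro borel_measurable_indicator) auto
        show "g n \<in> borel_measurable M" for n
          using borel_measurable_continuous_onI[OF cg] measurable_cong_sets[OF M(2) refl] by auto
        show "AE x in M. (\<lambda>n. g n x) \<longlonglongrightarrow> indicator K x" using lim by simp
        show "AE x in M. norm (g n x) \<le> 1" for n by (simp add: g_def infdist_nonneg)
      qed auto
      moreover have "integral\<^sup>L M (indicator K) = measure M K"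
        using sets_eq_imp_space_eq[OF M(2)] by simp
      ultimately show ?thesis by simp
    qed
    have "measure \<mu> K = measure \<nu> K"
      using conv[OF \<mu>] conv[OF \<nu>] LIMSEQ_unique by (simp add: eq[OF cg])
    then show ?thesis by (simp add: \<mu>.emeasure_eq_measure \<nu>.emeasure_eq_measure)
  qed simp
  show ?thesis
  proof (rule measure_eqI_generator_eq[where E = "{K. closed K}" and \<Omega> = UNIV and A = "\<lambda>_. UNIV"])
    show "Int_stable {K :: 'm set. closed K}" by (auto simp: Int_stable_def)
    show "emeasure \<mu> X = emeasure \<nu> X" if "X \<in> {K. closed K}" for X using closed_eq that by simp
    show "sets \<mu> = sigma_sets UNIV {K. closed K}" "sets \<nu> = sigma_sets UNIV {K. closed K}"
      using \<mu>(2) \<nu>(2) by (simp_all add: borel_eq_closed)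
  qed auto
qed

section \<open>Ergodic measures of maximal subadditive growth\<close>

text \<open>On a compact space the type of bounded continuous functions carries all continuous
  functions. It serves as the vector space on which extreme functionals are sought.\<close>

lemma apply_Bcontfun_compact:
  assumes "compact (UNIV :: 'm::metric_space set)" "continuous_on UNIV (g :: 'm \<Rightarrow> real)"
  shows "apply_bcontfun (Bcontfun g) = g"
  using compact_imp_bounded[OF compact_continuous_image[OF assms(2,1)]] assms(2)
  by (intro Bcontfun_inverse) (auto simp: bcontfun_def)

locale compact_dynamics =
  fixes f :: "'m::metric_space \<Rightarrow> 'm"
  assumes compact: "compact (UNIV :: 'm set)" and cont_f: "continuous_on UNIV f"
begin

lemma cont_funpow: "continuous_on UNIV (f ^^ n)"
proof (induction n)
  case (Suc n)
  then show ?case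
    using continuous_on_compose[OF Suc, of f] cont_f by (auto intro: continuous_on_subset)
qed (simp add: id_def)

lemma cont_comp: "continuous_on UNIV g \<Longrightarrow> continuous_on UNIV (\<lambda>x. g ((f ^^ n) x))"
  using continuous_on_compose2[OF _ cont_funpow] by auto

lemma cont_comp1: "continuous_on UNIV g \<Longrightarrow> continuous_on UNIV (\<lambda>x. g (f x))"
  using continuous_on_compose2[OF _ cont_f] by auto

lemma Bcontfun_add:
  "continuous_on UNIV g \<Longrightarrow> continuous_on UNIV h \<Longrightarrow>
    Bcontfun (\<lambda>x. g x + h x :: real) = Bcontfun g + Bcontfun (h :: 'm \<Rightarrow> real)"
  by (rule bcontfun_eqI) (simp add: apply_Bcontfun_compact[OF compact] continuous_on_add)

lemma Bcontfun_scale: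
  "continuous_on UNIV g \<Longrightarrow> Bcontfun (\<lambda>x. c * g x :: real) = c *\<^sub>R Bcontfun (g :: 'm \<Rightarrow> real)"
  by (rule bcontfun_eqI) (simp add: apply_Bcontfun_compact[OF compact] continuous_on_mult_left)

text \<open>The invariant probability measures as functionals. Positivity is phrased as an upper
  bound because upper bounds are what a functional inherits from a sublinear one above it.\<close>

definition invariant_state :: "(('m \<Rightarrow>\<^sub>C real) \<Rightarrow> real) \<Rightarrow> bool" where
  "invariant_state l \<longleftrightarrow> linear l \<and> (\<forall>\<phi>. (\<forall>x. apply_bcontfun \<phi> x \<le> 0) \<longrightarrow> l \<phi> \<le> 0) \<and>
     l (Bcontfun (\<lambda>_. 1)) = 1 \<and>
     (\<forall>g. continuous_on UNIV g \<longrightarrow> l (Bcontfun (\<lambda>x. g (f x))) = l (Bcontfun g))"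

lemma invariant_stateD:
  assumes "invariant_state l"
  shows "linear l" "\<And>\<phi>. (\<And>x. apply_bcontfun \<phi> x \<le> 0) \<Longrightarrow> l \<phi> \<le> 0" "l (Bcontfun (\<lambda>_. 1)) = 1"
    "\<And>g. continuous_on UNIV g \<Longrightarrow> l (Bcontfun (\<lambda>x. g (f x))) = l (Bcontfun g)"
  using assms by (auto simp: invariant_state_def)

lemma prob_functional_invariant_state:
  assumes "invariant_state l"
  shows "prob_functional (\<lambda>g. l (Bcontfun g))"
proof
  note l = invariant_stateD[OF assms]
  fix g h :: "'m \<Rightarrow> real" and c
  assume g: "continuous_on UNIV g"
  show "l (Bcontfun (\<lambda>x. c * g x)) = c * l (Bcontfun g)"
    by (simp add: Bcontfun_scale[OF g] linear_scale[OF l(1)])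
  show "0 \<le> l (Bcontfun g)" if "\<And>x. 0 \<le> g x"
    using l(2)[of "- Bcontfun g"] that by (simp add: apply_Bcontfun_compact[OF compact g] linear_neg[OF l(1)])
  assume h: "continuous_on UNIV h"
  show "l (Bcontfun (\<lambda>x. g x + h x)) = l (Bcontfun g) + l (Bcontfun h)"
    by (simp add: Bcontfun_add[OF g h] linear_add[OF l(1)])
qed (rule invariant_stateD(3)[OF assms])

lemma invariant_state_funpow:
  assumes "invariant_state l" "continuous_on UNIV g"
  shows "l (Bcontfun (\<lambda>x. g ((f ^^ n) x))) = l (Bcontfun g)"
proof (induction n)
  case (Suc n)
  have "l (Bcontfun (\<lambda>x. g ((f ^^ n) (f x)))) = l (Bcontfun (\<lambda>x. g ((f ^^ n) x)))"
    using invariant_stateD(4)[OF assms(1) cont_comp[OF assms(2), of n]] .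
  with Suc show ?case by (simp only: funpow_Suc_right o_apply)
qed simp

lemma invariant_state_le_norm:
  assumes "invariant_state l"
  shows "l \<phi> \<le> norm \<phi>"
proof -
  interpret prob_functional "\<lambda>g. l (Bcontfun g)" by (rule prob_functional_invariant_state[OF assms])
  have "l (Bcontfun (apply_bcontfun \<phi>)) \<le> l (Bcontfun (\<lambda>_. norm \<phi>))"
    using norm_bounded[of \<phi>] by (intro mono) (auto simp: abs_le_iff)
  then show ?thesis using const[of "norm \<phi>"] by (simp add: apply_bcontfun_inverse)
qed

end

text \<open>The two growth assumptions say that \<gamma> is the infimum over n > 0 of the maximum of
  \<open>b n\<close> divided by n.\<close>

locale subadditive_dynamics = compact_dynamics f for f :: "'m::metric_space \<Rightarrow> 'm" +
  fixes b :: "nat \<Rightarrow> 'm \<Rightarrow> real" and \<gamma> :: real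
  assumes cont_b: "continuous_on UNIV (b n)"
    and b_zero: "b 0 q = 0"
    and subadd: "b (n + m) q \<le> b n ((f ^^ m) q) + b m q"
    and growth_lower: "\<exists>q. b n q \<ge> real n * \<gamma>"
    and growth_upper: "\<epsilon> > 0 \<Longrightarrow> \<exists>n>0. \<forall>q. b n q \<le> real n * (\<gamma> + \<epsilon>)"
begin

definition maximizing_state :: "(('m \<Rightarrow>\<^sub>C real) \<Rightarrow> real) \<Rightarrow> bool" where
  "maximizing_state l \<longleftrightarrow> invariant_state l \<and> (\<forall>m. real m * \<gamma> \<le> l (Bcontfun (b m)))"

lemma invariant_state_mult_le:
  assumes l: "invariant_state l"
  shows "l (Bcontfun (b (n * m))) \<le> real n * l (Bcontfun (b m))"
proof (induction n)
  case 0
  interpret prob_functional "\<lambda>g. l (Bcontfun g)" by (rule prob_functional_invariant_state[OF l])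
  have "b 0 = (\<lambda>_. 0)" using b_zero by auto
  then show ?case using const[of 0] by simp
next
  case (Suc n)
  interpret prob_functional "\<lambda>g. l (Bcontfun g)" by (rule prob_functional_invariant_state[OF l])
  have "l (Bcontfun (b (Suc n * m))) \<le> l (Bcontfun (\<lambda>q. b m ((f ^^ (n * m)) q) + b (n * m) q))"
    using subadd[of m "n * m"] by (intro mono continuous_on_add cont_comp cont_b) simp_all
  also have "\<dots> = l (Bcontfun (b m)) + l (Bcontfun (b (n * m)))"
    by (simp add: add cont_comp cont_b invariant_state_funpow[OF l])
  also have "\<dots> \<le> real (Suc n) * l (Bcontfun (b m))"
    using Suc by (simp add: algebra_simps)
  finally show ?case .
qed

text \<open>The growth rate of \<open>b\<close> is affine on invariant states and bounded by \<open>\<gamma>\<close>, so it equals \<open>\<gamma>\<close> at a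
  convex combination only if it does at both ends.\<close>

lemma maximizing_state_face:
  assumes l: "maximizing_state l" and l1: "invariant_state l1" and l2: "invariant_state l2"
    and t: "0 < t" "t < 1" and eq: "\<And>\<phi>. l \<phi> = t * l1 \<phi> + (1 - t) * l2 \<phi>"
  shows "maximizing_state l1"
  unfolding maximizing_state_def
proof (intro conjI l1 allI)
  fix m
  interpret L2: prob_functional "\<lambda>g. l2 (Bcontfun g)" by (rule prob_functional_invariant_state[OF l2])
  show "real m * \<gamma> \<le> l1 (Bcontfun (b m))"
  proof (rule ccontr)
    assume neg: "\<not> real m * \<gamma> \<le> l1 (Bcontfun (b m))"
    have "m \<noteq> 0"
    proof
      assume "m = 0"
      \<comment> \<open>For m = 0 the value v of \<open>l1\<close> at \<open>b 0\<close> satisfies v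
        \<le> 2 v, so v is nonnegative.\<close>
      then show False using neg invariant_state_mult_le[OF l1, of 2 0] by simp
    qed
    then have m: "real m > 0" by simp
    define \<delta> where "\<delta> = real m * \<gamma> - l1 (Bcontfun (b m))"
    have \<delta>: "\<delta> > 0" using neg by (simp add: \<delta>_def)
    \<comment> \<open>This \<epsilon> limits the excess contributed by \<open>l2\<close> to (1 - t)
      t \<delta> per n steps' worth of \<open>b m\<close>, strictly less than the deficit t \<delta>
      contributed by \<open>l1\<close>.\<close>
    define \<epsilon> where "\<epsilon> = t * \<delta> / real m"
    have \<epsilon>: "\<epsilon> > 0" "real m * \<epsilon> = t * \<delta>" using t \<delta> m by (auto simp: \<epsilon>_def)
    obtain n where n: "n > 0" "\<And>q. b n q \<le> real n * (\<gamma> + \<epsilon>)" using growth_upper[OF \<epsilon>(1)] by auto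
    have "l2 (Bcontfun (b n)) \<le> real n * (\<gamma> + \<epsilon>)"
      using L2.mono[OF cont_b _ n(2)] L2.const by simp
    then have "real m * l2 (Bcontfun (b n)) \<le> real m * (real n * (\<gamma> + \<epsilon>))"
      using m by simp
    then have 2: "l2 (Bcontfun (b (m * n))) \<le> real m * (real n * (\<gamma> + \<epsilon>))"
      using invariant_state_mult_le[OF l2, of m n] by linarith
    have 1: "l1 (Bcontfun (b (m * n))) \<le> real n * (real m * \<gamma> - \<delta>)"
      using invariant_state_mult_le[OF l1, of n m] by (simp add: \<delta>_def mult.commute)
    have "real (m * n) * \<gamma> \<le> t * l1 (Bcontfun (b (m * n))) + (1 - t) * l2 (Bcontfun (b (m * n)))"
      using l eq unfolding maximizing_state_def by metis
    also have "\<dots> \<le> t * (real n * (real m * \<gamma> - \<delta>)) + (1 - t) * (real m * (real n * (\<gamma> + \<epsilon>)))"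
      using t 1 2 by (intro add_mono mult_left_mono) auto
    also have "\<dots> = real (m * n) * \<gamma> + real n * ((1 - t) * (real m * \<epsilon>) - t * \<delta>)"
      by (simp add: algebra_simps)
    also have "(1 - t) * (real m * \<epsilon>) - t * \<delta> = - (t * (t * \<delta>))"
      unfolding \<epsilon>(2) by (simp add: algebra_simps)
    finally have "real n * (t * (t * \<delta>)) \<le> 0" by simp
    moreover have "real n * (t * (t * \<delta>)) > 0" using n(1) t \<delta> by simp
    ultimately show False by simp
  qed
qed

text \<open>The error does not depend on n, so it disappears in time averages. The initial sum
  \<open>V 0\<close>, the comparison of \<open>V (n - m)\<close> with \<open>b n q\<close>, and the
  last m terms of the Birkhoff sum cost m D each.\<close>

lemma birkhoff_sum_lower:
  assumes D: "\<And>k x. k \<le> m \<Longrightarrow> \<bar>b k x\<bar> \<le> D" and mn: "m \<le> n"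
  shows "real m * b n q - 3 * real m * D \<le> (\<Sum>k<n. b m ((f ^^ k) q))"
proof -
  \<comment> \<open>Summing over \<open>m\<close> consecutive lengths turns subadditivity into a telescoping estimate with step one.\<close>
  define V where "V k = (\<Sum>j<m. b (k + j) q)" for k
  have step: "V (Suc k) \<le> V k + b m ((f ^^ k) q)" for k
  proof -
    have "V (Suc k) + b k q = (\<Sum>j<Suc m. b (k + j) q)"
      unfolding V_def by (subst sum.lessThan_Suc_shift) simp
    also have "\<dots> = V k + b (k + m) q" by (simp add: V_def)
    also have "\<dots> \<le> V k + (b m ((f ^^ k) q) + b k q)"
      using subadd[of m k q] by (simp add: add.commute)
    finally show ?thesis by simp
  qed
  have V_le: "V k \<le> V 0 + (\<Sum>i<k. b m ((f ^^ i) q))" for k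
  proof (induction k)
    case (Suc k)
    then show ?case using step[of k] by simp
  qed simp
  have V0: "V 0 \<le> real m * D"
  proof -
    have "V 0 \<le> (\<Sum>j<m. D)"
      unfolding V_def using D by (intro sum_mono) (simp add: abs_le_iff)
    then show ?thesis by simp
  qed
  have lower: "real m * (b n q - D) \<le> V (n - m)"
  proof -
    have "b n q - D \<le> b (n - m + j) q" if "j < m" for j
    proof -
      have "b n q \<le> b (m - j) ((f ^^ (n - m + j)) q) + b (n - m + j) q"
        using subadd[of "m - j" "n - m + j" q] that mn by simp
      then show ?thesis using D[of "m - j" "(f ^^ (n - m + j)) q"] by (simp add: abs_le_iff)
    qed
    then have "(\<Sum>j<m. b n q - D) \<le> V (n - m)"
      unfolding V_def by (intro sum_mono) auto
    then show ?thesis by simp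
  qed
  have "(\<Sum>k<n. b m ((f ^^ k) q)) = (\<Sum>k<n - m. b m ((f ^^ k) q)) + (\<Sum>k=n-m..<n. b m ((f ^^ k) q))"
    using mn by (simp add: sum.atLeastLessThan_concat lessThan_atLeast0)
  moreover have "(\<Sum>k=n-m..<n. - D) \<le> (\<Sum>k=n-m..<n. b m ((f ^^ k) q))"
    using D[of m] by (intro sum_mono) (simp add: abs_le_iff minus_le_iff)
  ultimately have "(\<Sum>k<n - m. b m ((f ^^ k) q)) - real m * D \<le> (\<Sum>k<n. b m ((f ^^ k) q))"
    using mn by simp
  with V_le[of "n - m"] V0 lower show ?thesis by (simp add: algebra_simps)
qed

end

section \<open>Upper limits of empirical averages\<close>

context compact_dynamics
begin

text \<open>The starting point \<open>q n\<close> varies with the length n because the points of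
  large growth do.\<close>

definition empirical_average :: "(nat \<Rightarrow> 'm) \<Rightarrow> nat \<Rightarrow> ('m \<Rightarrow>\<^sub>C real) \<Rightarrow> real" where
  "empirical_average q n \<phi> = (\<Sum>k<n. apply_bcontfun \<phi> ((f ^^ k) (q n))) / real n"

text \<open>The limit superior of the averages, as the infimum of their eventual upper bounds;
  sublinearity then follows by combining bounds.\<close>

definition upper_average :: "(nat \<Rightarrow> 'm) \<Rightarrow> ('m \<Rightarrow>\<^sub>C real) \<Rightarrow> real" where
  "upper_average q \<phi> = Inf {c. \<forall>\<^sub>F n in sequentially. empirical_average q n \<phi> \<le> c}"

lemma empirical_average_le:
  assumes "\<And>x. apply_bcontfun \<phi> x \<le> c" "n > 0"
  shows "empirical_average q n \<phi> \<le> c"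
proof -
  have "(\<Sum>k<n. apply_bcontfun \<phi> ((f ^^ k) (q n))) \<le> (\<Sum>k<n. c)"
    using assms by (intro sum_mono)
  then show ?thesis using assms by (simp add: empirical_average_def field_simps)
qed

lemma empirical_average_ge:
  assumes "\<And>x. c \<le> apply_bcontfun \<phi> x" "n > 0"
  shows "c \<le> empirical_average q n \<phi>"
proof -
  have "(\<Sum>k<n. c) \<le> (\<Sum>k<n. apply_bcontfun \<phi> ((f ^^ k) (q n)))"
    using assms by (intro sum_mono)
  then show ?thesis using assms by (simp add: empirical_average_def field_simps)
qed

lemma eventually_imp_ge_lower:
  assumes "\<forall>\<^sub>F n in sequentially. empirical_average q n \<phi> \<le> c"
  shows "- norm \<phi> \<le> c"
proof -
  have "\<forall>\<^sub>F n in sequentially. n > 0 \<and> empirical_average q n \<phi> \<le> c"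
    using assms eventually_gt_at_top[of 0] by eventually_elim auto
  then obtain n where n: "n > 0" "empirical_average q n \<phi> \<le> c"
    by (auto dest: eventually_happens)
  have "- norm \<phi> \<le> empirical_average q n \<phi>"
    using norm_bounded[of \<phi>] n(1) by (intro empirical_average_ge) (auto simp: abs_le_iff minus_le_iff)
  with n(2) show ?thesis by simp
qed

lemma upper_average_le:
  assumes "\<forall>\<^sub>F n in sequentially. empirical_average q n \<phi> \<le> c"
  shows "upper_average q \<phi> \<le> c"
  unfolding upper_average_def
  by (rule cInf_lower) (use assms in \<open>auto intro!: bdd_belowI eventually_imp_ge_lower\<close>)

lemma upper_average_greatest:
  assumes "\<And>c. \<forall>\<^sub>F n in sequentially. empirical_average q n \<phi> \<le> c \<Longrightarrow> a \<le> c"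
  shows "a \<le> upper_average q \<phi>"
  unfolding upper_average_def
proof (rule cInf_greatest)
  have "\<forall>\<^sub>F n in sequentially. empirical_average q n \<phi> \<le> norm \<phi>"
    using eventually_gt_at_top[of 0]
    by eventually_elim (use norm_bounded[of \<phi>] in \<open>auto intro!: empirical_average_le simp: abs_le_iff\<close>)
  then show "{c. \<forall>\<^sub>F n in sequentially. empirical_average q n \<phi> \<le> c} \<noteq> {}" by auto
qed (use assms in auto)

lemma sublinear_upper_average: "sublinear (upper_average q)"
proof (rule sublinearI)
  fix \<phi> \<psi>
  have *: "upper_average q (\<phi> + \<psi>) \<le> c + d"
    if c: "\<forall>\<^sub>F n in sequentially. empirical_average q n \<phi> \<le> c"
    and d: "\<forall>\<^sub>F n in sequentially. empirical_average q n \<psi> \<le> d" for c d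
  proof (rule upper_average_le)
    show "\<forall>\<^sub>F n in sequentially. empirical_average q n (\<phi> + \<psi>) \<le> c + d"
      using c d by eventually_elim (simp add: empirical_average_def sum.distrib add_divide_distrib)
  qed
  have "upper_average q (\<phi> + \<psi>) - upper_average q \<psi> \<le> c"
    if c: "\<forall>\<^sub>F n in sequentially. empirical_average q n \<phi> \<le> c" for c
  proof -
    have "upper_average q (\<phi> + \<psi>) - c \<le> upper_average q \<psi>"
      by (rule upper_average_greatest) (use *[OF c] in \<open>simp add: algebra_simps\<close>)
    then show ?thesis by simp
  qed
  then have "upper_average q (\<phi> + \<psi>) - upper_average q \<psi> \<le> upper_average q \<phi>"
    by (rule upper_average_greatest)
  then show "upper_average q (\<phi> + \<psi>) \<le> upper_average q \<phi> + upper_average q \<psi>" by simp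
next
  fix c :: real and \<phi> assume c: "c > 0"
  have "upper_average q (c *\<^sub>R \<phi>) / c \<le> upper_average q \<phi>"
  proof (rule upper_average_greatest)
    fix d assume d: "\<forall>\<^sub>F n in sequentially. empirical_average q n \<phi> \<le> d"
    have scaled: "empirical_average q n (c *\<^sub>R \<phi>) = c * empirical_average q n \<phi>" for n
      by (simp add: empirical_average_def sum_distrib_left)
    have "upper_average q (c *\<^sub>R \<phi>) \<le> c * d"
      by (rule upper_average_le, rule eventually_mono[OF d]) (use c scaled in simp)
    then show "upper_average q (c *\<^sub>R \<phi>) / c \<le> d" using c by (simp add: field_simps)
  qed
  then show "upper_average q (c *\<^sub>R \<phi>) \<le> c * upper_average q \<phi>" using c by (simp add: field_simps)
next
  have "empirical_average q n 0 = 0" for n by (simp add: empirical_average_def)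
  then show "upper_average q 0 = 0"
    by (intro antisym upper_average_le upper_average_greatest) auto
qed

lemma upper_average_le_limit:
  assumes "\<And>n. n \<ge> N \<Longrightarrow> n > 0 \<Longrightarrow> empirical_average q n \<phi> \<le> a + c / real n"
  shows "upper_average q \<phi> \<le> a"
proof (rule field_le_epsilon)
  fix e :: real assume e: "e > 0"
  have "(\<lambda>n. c / real n) \<longlonglongrightarrow> 0" by (rule lim_const_over_n)
  then have "\<forall>\<^sub>F n in sequentially. c / real n < e" using e by (rule order_tendstoD(2))
  then have "\<forall>\<^sub>F n in sequentially. empirical_average q n \<phi> \<le> a + e"
    using eventually_gt_at_top[of 0] eventually_ge_at_top[of N]
  proof eventually_elim
    case (elim n) then show ?case using assms[of n] by simp
  qed
  then show "upper_average q \<phi> \<le> a + e" by (rule upper_average_le)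
qed

text \<open>The Krylov-Bogolyubov argument for functionals: sums of g o f - g along an orbit
  telescope, so the averages of this function and of its negative are at most of order 1/n, and a
  functional below the upper average vanishes on it.\<close>

lemma invariant_state_below_upper_average:
  assumes l: "linear l" and le: "\<And>\<phi>. l \<phi> \<le> upper_average q \<phi>"
  shows "invariant_state l"
  unfolding invariant_state_def
proof (intro conjI allI impI l)
  have bound: "l \<phi> \<le> c" if "\<And>x. apply_bcontfun \<phi> x \<le> c" for \<phi> c
    by (rule order_trans[OF le], rule upper_average_le_limit[of 0 _ _ _ 0])
       (use that in \<open>auto intro: empirical_average_le\<close>)
  show "l \<phi> \<le> 0" if "\<forall>x. apply_bcontfun \<phi> x \<le> 0" for \<phi> using bound that by blast
  have one: "apply_bcontfun (Bcontfun (\<lambda>_. 1)) = (\<lambda>x :: 'm. 1 :: real)"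
    by (rule apply_Bcontfun_compact[OF compact]) simp
  have "l (Bcontfun (\<lambda>_. 1)) \<le> 1" "l (- Bcontfun (\<lambda>_. 1)) \<le> - 1"
    by (rule bound; simp add: one)+
  then show "l (Bcontfun (\<lambda>_. 1)) = 1" by (simp add: linear_neg[OF l])
  fix g :: "'m \<Rightarrow> real" assume g: "continuous_on UNIV g"
  define \<phi> where "\<phi> = Bcontfun (\<lambda>x. g (f x)) - Bcontfun g"
  define B where "B = norm (Bcontfun g)"
  have B: "\<bar>g x\<bar> \<le> B" for x
    using norm_bounded[of "Bcontfun g" x] by (simp add: B_def apply_Bcontfun_compact[OF compact g])
  have \<phi>: "apply_bcontfun \<phi> x = g (f x) - g x" for x
    by (simp add: \<phi>_def apply_Bcontfun_compact[OF compact] g cont_comp1)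
  have tele: "(\<Sum>k<n. apply_bcontfun \<phi> ((f ^^ k) x)) = g ((f ^^ n) x) - g x" for n x
    by (induction n) (auto simp: \<phi>)
  have "empirical_average q n \<phi> \<le> 0 + 2 * B / real n" for n
    using B[of "(f ^^ n) (q n)"] B[of "q n"]
    by (auto simp: empirical_average_def tele intro!: divide_right_mono)
  then have 1: "l \<phi> \<le> 0"
    by (intro order_trans[OF le] upper_average_le_limit)
  have tele': "(\<Sum>k<n. apply_bcontfun (- \<phi>) ((f ^^ k) x)) = g x - g ((f ^^ n) x)" for n x
    by (induction n) (auto simp: \<phi>)
  have "empirical_average q n (- \<phi>) \<le> 0 + 2 * B / real n" for n
    using B[of "(f ^^ n) (q n)"] B[of "q n"]
    unfolding empirical_average_def tele' by (auto intro!: divide_right_mono)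
  then have "l (- \<phi>) \<le> 0"
    by (intro order_trans[OF le] upper_average_le_limit)
  with 1 have "l \<phi> = 0" by (simp add: linear_neg[OF l])
  then show "l (Bcontfun (\<lambda>x. g (f x))) = l (Bcontfun g)"
    by (simp add: \<phi>_def linear_diff[OF l])
qed

end

section \<open>Maximizing states and their extreme points\<close>

context subadditive_dynamics
begin

text \<open>The averages are taken along orbits starting at points \<open>q n\<close> with
  \<open>b n (q n) \<ge> real n * \<gamma>\<close>. A lower bound for the functional at
  \<open>b m\<close> is obtained as an upper bound at \<open>- b m\<close>, where
  \<open>birkhoff_sum_lower\<close> applies.\<close>

lemma exists_maximizing_state: "\<exists>l. maximizing_state l"
proof -
  obtain q where q: "\<And>n. b n (q n) \<ge> real n * \<gamma>" using growth_lower by metis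
  obtain l where l: "linear l" "\<And>\<phi>. l \<phi> \<le> upper_average q \<phi>"
    using extreme_linear_below_sublinear[OF sublinear_upper_average[of q]] by metis
  have "real m * \<gamma> \<le> l (Bcontfun (b m))" for m
  proof -
    have "\<exists>D. \<forall>x. \<bar>b k x\<bar> \<le> D" for k
      using compact_imp_bounded[OF compact_continuous_image[OF cont_b compact], of k]
      by (auto simp: bounded_iff)
    then obtain D' where D': "\<And>k x. \<bar>b k x\<bar> \<le> D' k" by metis
    define D where "D = (\<Sum>k\<le>m. D' k)"
    have D: "\<bar>b k x\<bar> \<le> D" if "k \<le> m" for k x
    proof -
      have "D' j \<ge> 0" for j using D'[of j x] by linarith
      then have "D' k \<le> D" unfolding D_def using that by (intro member_le_sum) auto
      with D'[of k x] show ?thesis by linarith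
    qed
    have "empirical_average q n (- Bcontfun (b m)) \<le> - (real m * \<gamma>) + 3 * real m * D / real n"
      if n: "m \<le> n" "n > 0" for n
    proof -
      have "real m * (real n * \<gamma>) - 3 * real m * D \<le> real m * b n (q n) - 3 * real m * D"
        using q[of n] by (intro diff_mono mult_left_mono) auto
      also have "\<dots> \<le> (\<Sum>k<n. b m ((f ^^ k) (q n)))"
        using birkhoff_sum_lower[of m D n "q n"] D n(1) by blast
      finally show ?thesis using n(2)
        by (simp add: empirical_average_def apply_Bcontfun_compact[OF compact cont_b] sum_negf field_simps)
    qed
    then have "l (- Bcontfun (b m)) \<le> - (real m * \<gamma>)"
      by (intro order_trans[OF l(2)] upper_average_le_limit)
    then show ?thesis by (simp add: linear_neg[OF l(1)])
  qed
  with invariant_state_below_upper_average[OF l] show ?thesis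
    by (auto simp: maximizing_state_def)
qed

text \<open>The support function of the set of maximizing states, which puts this set into the form
  required by \<open>extreme_linear_below_sublinear\<close>.\<close>

definition maximal_value :: "('m \<Rightarrow>\<^sub>C real) \<Rightarrow> real" where
  "maximal_value \<phi> = (SUP l\<in>Collect maximizing_state. l \<phi>)"

lemma maximizing_state_le_maximal_value: "maximizing_state l \<Longrightarrow> l \<phi> \<le> maximal_value \<phi>"
  unfolding maximal_value_def
  by (rule cSUP_upper) (auto intro!: bdd_aboveI2[where M = "norm \<phi>"] invariant_state_le_norm simp: maximizing_state_def)

lemma maximal_value_least: "(\<And>l. maximizing_state l \<Longrightarrow> l \<phi> \<le> c) \<Longrightarrow> maximal_value \<phi> \<le> c"
  unfolding maximal_value_def by (rule cSUP_least) (use exists_maximizing_state in auto)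

lemma maximizing_state_linear: "maximizing_state l \<Longrightarrow> linear l"
  by (auto simp: maximizing_state_def invariant_state_def)

lemma sublinear_maximal_value: "sublinear maximal_value"
proof (rule sublinearI)
  show "maximal_value (\<phi> + \<psi>) \<le> maximal_value \<phi> + maximal_value \<psi>" for \<phi> \<psi>
    by (rule maximal_value_least)
       (auto simp: linear_add[OF maximizing_state_linear] intro!: add_mono maximizing_state_le_maximal_value)
  show "maximal_value (c *\<^sub>R \<phi>) \<le> c * maximal_value \<phi>" if "c > 0" for c \<phi>
    by (rule maximal_value_least)
       (use that in \<open>auto simp: linear_scale[OF maximizing_state_linear] intro!: mult_left_mono maximizing_state_le_maximal_value\<close>)
  show "maximal_value 0 = 0"
  proof (rule antisym)
    show "maximal_value 0 \<le> 0"
      by (rule maximal_value_least) (simp add: linear_0[OF maximizing_state_linear])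
    obtain l where "maximizing_state l" using exists_maximizing_state by auto
    then show "0 \<le> maximal_value 0"
      using maximizing_state_le_maximal_value[of l 0] by (simp add: linear_0[OF maximizing_state_linear])
  qed
qed

text \<open>Every condition on a maximizing state, equations included, amounts to upper bounds at
  suitable vectors and their negatives; such bounds pass to the supremum over all maximizing states
  and from there to any linear functional below it.\<close>

lemma maximizing_state_iff:
  assumes l: "linear l"
  shows "maximizing_state l \<longleftrightarrow> (\<forall>\<phi>. l \<phi> \<le> maximal_value \<phi>)"
proof
  assume le: "\<forall>\<phi>. l \<phi> \<le> maximal_value \<phi>"
  have bound: "l \<phi> \<le> c" if "\<And>l'. maximizing_state l' \<Longrightarrow> l' \<phi> \<le> c" for \<phi> c
    using le maximal_value_least[OF that] by (meson order_trans)
  have lin: "linear l'" if "maximizing_state l'" for l' by (rule maximizing_state_linear[OF that])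
  have inv: "invariant_state l'" if "maximizing_state l'" for l' using that by (simp add: maximizing_state_def)
  show "maximizing_state l" unfolding maximizing_state_def invariant_state_def
  proof (intro conjI allI impI l)
    show "l \<phi> \<le> 0" if "\<forall>x. apply_bcontfun \<phi> x \<le> 0" for \<phi>
      by (rule bound) (use that inv in \<open>auto simp: invariant_state_def\<close>)
    have "l (Bcontfun (\<lambda>_. 1)) \<le> 1" "l (- Bcontfun (\<lambda>_. 1)) \<le> - 1"
      by (rule bound; simp add: linear_neg[OF lin] invariant_stateD(3)[OF inv])+
    then show "l (Bcontfun (\<lambda>_. 1)) = 1" by (simp add: linear_neg[OF l])
    show "l (Bcontfun (\<lambda>x. g (f x))) = l (Bcontfun g)" if g: "continuous_on UNIV g" for g
    proof -
      have "l (Bcontfun (\<lambda>x. g (f x)) - Bcontfun g) \<le> 0" "l (Bcontfun g - Bcontfun (\<lambda>x. g (f x))) \<le> 0"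
        by (rule bound; simp add: linear_diff[OF lin] invariant_stateD(4)[OF inv g])+
      then show ?thesis by (simp add: linear_diff[OF l])
    qed
    have "l (- Bcontfun (b m)) \<le> - (real m * \<gamma>)" for m
      by (rule bound) (simp add: linear_neg[OF lin] maximizing_state_def)
    then show "real m * \<gamma> \<le> l (Bcontfun (b m))" for m by (simp add: linear_neg[OF l])
  qed
qed (auto intro: maximizing_state_le_maximal_value)

text \<open>Extremality holds against all invariant states, since the face property puts both ends
  of the segment among the maximizing ones. This matters because conditional measures are only known
  to be invariant.\<close>

theorem exists_extreme_maximizing_state:
  obtains l where "maximizing_state l"
    "\<And>l1 l2 t. invariant_state l1 \<Longrightarrow> invariant_state l2 \<Longrightarrow> 0 < t \<Longrightarrow> t < 1 \<Longrightarrow>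
       (\<And>\<phi>. l \<phi> = t * l1 \<phi> + (1 - t) * l2 \<phi>) \<Longrightarrow> l1 = l"
proof -
  obtain l where l: "linear l" "\<And>x. l x \<le> maximal_value x" and
    extreme: "\<And>l1 l2 t. linear l1 \<Longrightarrow> linear l2 \<Longrightarrow> (\<And>x. l1 x \<le> maximal_value x) \<Longrightarrow>
      (\<And>x. l2 x \<le> maximal_value x) \<Longrightarrow> 0 < t \<Longrightarrow> t < 1 \<Longrightarrow> (\<And>x. l x = t * l1 x + (1 - t) * l2 x) \<Longrightarrow> l1 = l"
    using extreme_linear_below_sublinear[OF sublinear_maximal_value] by blast
  have max: "maximizing_state l" using l maximizing_state_iff by blast
  show thesis
  proof (rule that[OF max])
    fix l1 l2 and t :: real
    assume inv: "invariant_state l1" "invariant_state l2" and t: "0 < t" "t < 1"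
      and eq: "\<And>\<phi>. l \<phi> = t * l1 \<phi> + (1 - t) * l2 \<phi>"
    have m1: "maximizing_state l1" by (rule maximizing_state_face[OF max inv t eq])
    have m2: "maximizing_state l2"
      by (rule maximizing_state_face[OF max inv(2,1), of "1 - t"]) (use t eq in auto)
    show "l1 = l"
      using extreme[of l1 l2 t] t eq m1 m2 maximizing_state_le_maximal_value maximizing_state_linear by blast
  qed
qed

text \<open>An invariant set B of measure strictly between 0 and 1 would split the state into its
  normalized restrictions to B and to the complement. By extremality the restriction to B is the
  state itself, which forces B to have measure 1.\<close>

theorem exists_ergodic_maximizing_measure:
  obtains \<nu> where "\<nu> \<in> ergodic_prob_measures f" "\<And>m. real m * \<gamma> \<le> integral\<^sup>L \<nu> (b m)"
proof -
  obtain l where max: "maximizing_state l" and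
    extreme: "\<And>l1 l2 t. invariant_state l1 \<Longrightarrow> invariant_state l2 \<Longrightarrow> 0 < t \<Longrightarrow> t < 1 \<Longrightarrow>
       (\<And>\<phi>. l \<phi> = t * l1 \<phi> + (1 - t) * l2 \<phi>) \<Longrightarrow> l1 = l"
    using exists_extreme_maximizing_state by blast
  have inv: "invariant_state l" using max by (simp add: maximizing_state_def)
  interpret L: prob_functional "\<lambda>g. l (Bcontfun g)" by (rule prob_functional_invariant_state[OF inv])
  obtain \<nu> where prob: "prob_space \<nu>" and sets: "sets \<nu> = sets borel"
    and int: "\<And>g. continuous_on UNIV g \<Longrightarrow> integral\<^sup>L \<nu> g = l (Bcontfun g)"
    using L.riesz_representation[OF compact] by metis
  interpret prob_space \<nu> by fact
  have sp: "space \<nu> = UNIV" using sets_eq_imp_space_eq[OF sets] by simp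
  have f_meas: "f \<in> measurable \<nu> \<nu>" "f \<in> measurable \<nu> borel"
    using borel_measurable_continuous_onI[OF cont_f] sets
    by (simp_all cong: measurable_cong_sets)
  have g_meas: "g \<in> borel_measurable \<nu>" if "continuous_on UNIV g" for g :: "'m \<Rightarrow> real"
    using borel_measurable_continuous_onI[OF that] sets by (simp cong: measurable_cong_sets)
  have distr: "distr \<nu> \<nu> f = \<nu>"
  proof (rule prob_measure_eqI_continuous)
    show "prob_space (distr \<nu> \<nu> f)" by (rule prob_space_distr[OF f_meas(1)])
    fix g :: "'m \<Rightarrow> real" assume g: "continuous_on UNIV g"
    have "integral\<^sup>L (distr \<nu> \<nu> f) g = integral\<^sup>L \<nu> (\<lambda>x. g (f x))"
      by (rule integral_distr[OF f_meas(1) g_meas[OF g]])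
    then show "integral\<^sup>L (distr \<nu> \<nu> f) g = integral\<^sup>L \<nu> g"
      by (simp add: int g cont_comp1 invariant_stateD(4)[OF inv])
  qed (auto simp: prob sets)
  have inv_meas: "\<nu> \<in> invariant_prob_measures f"
  proof -
    have "emeasure \<nu> (f -` B) = emeasure \<nu> B" if "B \<in> sets borel" for B
      using emeasure_distr[OF f_meas(1), of B] that distr by (simp add: sets sp)
    then show ?thesis by (simp add: invariant_prob_measures_def prob sets)
  qed
  have bounded: "integrable \<nu> (\<lambda>x. indicator B x * apply_bcontfun \<phi> x)" if "B \<in> sets borel" for B and \<phi> :: "'m \<Rightarrow>\<^sub>C real"
    using that norm_bounded[of \<phi>] sets g_meas[of "apply_bcontfun \<phi>"]
    by (intro integrable_const_bound[where B = "norm \<phi>"])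
       (auto simp: indicator_def abs_le_iff intro!: borel_measurable_times borel_measurable_indicator)
  have cond_state: "invariant_state (\<lambda>\<phi>. (\<integral>x. indicator B x * apply_bcontfun \<phi> x \<partial>\<nu>) / measure \<nu> B)"
    if B: "B \<in> sets borel" "f -` B = B" "measure \<nu> B > 0" for B
    unfolding invariant_state_def
  proof (intro conjI allI impI)
    note bB = bounded[OF B(1)]
    show "linear (\<lambda>\<phi>. (\<integral>x. indicator B x * apply_bcontfun \<phi> x \<partial>\<nu>) / measure \<nu> B)"
    proof (rule linearI)
      fix \<phi> \<psi> :: "'m \<Rightarrow>\<^sub>C real" and c :: real
      show "(\<integral>x. indicator B x * apply_bcontfun (\<phi> + \<psi>) x \<partial>\<nu>) / measure \<nu> B =
        (\<integral>x. indicator B x * apply_bcontfun \<phi> x \<partial>\<nu>) / measure \<nu> B +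
        (\<integral>x. indicator B x * apply_bcontfun \<psi> x \<partial>\<nu>) / measure \<nu> B"
        using bB[of \<phi>] bB[of \<psi>] by (simp add: distrib_left add_divide_distrib)
      have "(\<integral>x. indicator B x * apply_bcontfun (c *\<^sub>R \<phi>) x \<partial>\<nu>) = (\<integral>x. c * (indicator B x * apply_bcontfun \<phi> x) \<partial>\<nu>)"
        by (simp add: algebra_simps)
      then show "(\<integral>x. indicator B x * apply_bcontfun (c *\<^sub>R \<phi>) x \<partial>\<nu>) / measure \<nu> B =
        c *\<^sub>R ((\<integral>x. indicator B x * apply_bcontfun \<phi> x \<partial>\<nu>) / measure \<nu> B)" by simp
    qed
    show "(\<integral>x. indicator B x * apply_bcontfun \<phi> x \<partial>\<nu>) / measure \<nu> B \<le> 0"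
      if "\<forall>x. apply_bcontfun \<phi> x \<le> 0" for \<phi>
    proof -
      have "(\<integral>x. indicator B x * apply_bcontfun \<phi> x \<partial>\<nu>) \<le> 0"
        using integral_mono[OF bB[of \<phi>], of "\<lambda>_. 0"] that by (simp add: indicator_def)
      then show ?thesis using B(3) by (simp add: divide_le_0_iff)
    qed
    show "(\<integral>x. indicator B x * apply_bcontfun (Bcontfun (\<lambda>_. 1)) x \<partial>\<nu>) / measure \<nu> B = 1"
      using B by (simp add: apply_Bcontfun_compact[OF compact] sp)
    fix g :: "'m \<Rightarrow> real" assume g: "continuous_on UNIV g"
    have m: "(\<lambda>x. indicator B x * g x) \<in> borel_measurable \<nu>"
      using g_meas[OF g] B(1) sets by (intro borel_measurable_times borel_measurable_indicator) auto
    have "(\<integral>x. indicator B x * g x \<partial>\<nu>) = (\<integral>x. indicator B (f x) * g (f x) \<partial>\<nu>)"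
      using integral_distr[OF f_meas(1) m] unfolding distr .
    also have "(\<lambda>x. indicator B (f x) * g (f x)) = (\<lambda>x. indicator B x * g (f x))"
      using B(2) by (auto simp: indicator_def fun_eq_iff)
    finally show "(\<integral>x. indicator B x * apply_bcontfun (Bcontfun (\<lambda>x. g (f x))) x \<partial>\<nu>) / measure \<nu> B =
        (\<integral>x. indicator B x * apply_bcontfun (Bcontfun g) x \<partial>\<nu>) / measure \<nu> B"
      by (simp add: apply_Bcontfun_compact[OF compact] g cont_comp1)
  qed
  have "measure \<nu> B = 0 \<or> measure \<nu> B = 1" if B: "B \<in> sets borel" "f -` B = B" for B
  proof (rule ccontr)
    assume neg: "\<not> (measure \<nu> B = 0 \<or> measure \<nu> B = 1)"
    define t where "t = measure \<nu> B"
    have t: "0 < t" "t < 1"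
      using neg measure_nonneg[of \<nu> B] prob_le_1[of B] unfolding t_def by linarith+
    have comp: "measure \<nu> (- B) = 1 - t"
      using prob_compl[of B] B(1) sets by (simp add: sp t_def Compl_eq_Diff_UNIV)
    have compl_B: "- B \<in> sets borel" "f -` (- B) = - B" using B by auto
    let ?l1 = "\<lambda>\<phi>. (\<integral>x. indicator B x * apply_bcontfun \<phi> x \<partial>\<nu>) / measure \<nu> B"
    let ?l2 = "\<lambda>\<phi>. (\<integral>x. indicator (- B) x * apply_bcontfun \<phi> x \<partial>\<nu>) / measure \<nu> (- B)"
    have "?l1 = l"
    proof (rule extreme)
      show "invariant_state ?l1" using cond_state[OF B] t by (simp add: t_def)
      show "invariant_state ?l2" using cond_state[OF compl_B] t comp by simp
      fix \<phi>
      have "t * ?l1 \<phi> + (1 - t) * ?l2 \<phi> =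
        (\<integral>x. indicator B x * apply_bcontfun \<phi> x \<partial>\<nu>) + (\<integral>x. indicator (- B) x * apply_bcontfun \<phi> x \<partial>\<nu>)"
        using t comp by (simp add: t_def)
      also have "\<dots> = (\<integral>x. indicator B x * apply_bcontfun \<phi> x + indicator (- B) x * apply_bcontfun \<phi> x \<partial>\<nu>)"
        by (rule Bochner_Integration.integral_add[symmetric]) (rule bounded[OF B(1)], rule bounded[OF compl_B(1)])
      also have "(\<lambda>x. indicator B x * apply_bcontfun \<phi> x + indicator (- B) x * apply_bcontfun \<phi> x) = apply_bcontfun \<phi>"
        by (auto simp: indicator_def)
      also have "integral\<^sup>L \<nu> (apply_bcontfun \<phi>) = l \<phi>"
        by (simp add: int apply_bcontfun_inverse)
      finally show "l \<phi> = t * ?l1 \<phi> + (1 - t) * ?l2 \<phi>" by simp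
    qed (use t in auto)
    have em: "emeasure \<nu> B = ennreal t" by (simp add: emeasure_eq_measure t_def)
    \<comment> \<open>The states agree on continuous functions, which do not see B directly;
      uniqueness of the measure carries the equality over to B.\<close>
    define \<kappa> where "\<kappa> = uniform_measure \<nu> B"
    have \<kappa>: "\<kappa> = density \<nu> (\<lambda>x. ennreal (indicator B x / t))"
      unfolding \<kappa>_def uniform_measure_def em using t
      by (intro arg_cong[where f = "density \<nu>"] ext) (auto simp: indicator_def divide_ennreal[symmetric])
    have "\<kappa> = \<nu>"
    proof (rule prob_measure_eqI_continuous)
      show "prob_space \<kappa>" unfolding \<kappa>_def
        by (rule prob_space_uniform_measure) (use em t in auto)
      show "sets \<kappa> = sets borel" by (simp add: \<kappa>_def sets)
      fix g :: "'m \<Rightarrow> real" assume g: "continuous_on UNIV g"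
      have "integral\<^sup>L \<kappa> g = (\<integral>x. (indicator B x / t) *\<^sub>R g x \<partial>\<nu>)"
        unfolding \<kappa> using t B(1) sets g_meas[OF g]
        by (intro integral_density) (auto intro!: borel_measurable_divide borel_measurable_indicator)
      also have "\<dots> = ?l1 (Bcontfun g)"
        by (simp add: apply_Bcontfun_compact[OF compact g] t_def)
      also have "\<dots> = integral\<^sup>L \<nu> g"
        unfolding int[OF g] using \<open>?l1 = l\<close> by (rule fun_cong)
      finally show "integral\<^sup>L \<kappa> g = integral\<^sup>L \<nu> g" .
    qed (auto simp: prob sets)
    moreover have "measure \<kappa> B = 1"
      unfolding \<kappa>_def using t em B(1) sets by (subst measure_uniform_measure) (auto simp: t_def)
    ultimately show False using neg by simp
  qed
  then have "\<nu> \<in> ergodic_prob_measures f"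
    using inv_meas by (simp add: ergodic_prob_measures_def)
  moreover have "real m * \<gamma> \<le> integral\<^sup>L \<nu> (b m)" for m
    using max by (simp add: int cont_b maximizing_state_def)
  ultimately show thesis by (rule that)
qed

end

section \<open>Recurrence\<close>

context compact_dynamics
begin

lemma vimage_funpow_borel: "B \<in> sets borel \<Longrightarrow> (f ^^ n) -` B \<in> sets borel"
  using measurable_sets[OF borel_measurable_continuous_onI[OF cont_funpow], of B n] by simp

lemma invariant_measure_vimage_funpow:
  assumes \<nu>: "\<nu> \<in> invariant_prob_measures f" and B: "B \<in> sets borel"
  shows "measure \<nu> ((f ^^ n) -` B) = measure \<nu> B"
proof (induction n)
  case (Suc n)
  have "emeasure \<nu> (f -` ((f ^^ n) -` B)) = emeasure \<nu> ((f ^^ n) -` B)"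
    using \<nu> vimage_funpow_borel[OF B, of n] by (simp add: invariant_prob_measures_def)
  then have "measure \<nu> (f -` ((f ^^ n) -` B)) = measure \<nu> ((f ^^ n) -` B)"
    by (simp add: measure_def)
  then show ?case by (simp only: Suc.IH vimage_comp funpow_Suc_right)
qed simp

text \<open>The set \<open>G\<close> of points that ever visit \<open>S\<close> only contains its
  preimage. The intersection \<open>R\<close> of all its iterated preimages is invariant, and since
  these decrease with constant measure, \<open>R\<close> has the measure of \<open>G\<close>, which
  is at least that of \<open>S\<close>.\<close>

lemma ergodic_visit_ae:
  assumes \<nu>: "\<nu> \<in> ergodic_prob_measures f" and S: "S \<in> sets borel" "measure \<nu> S > 0"
  shows "measure \<nu> (\<Union>t. (f ^^ t) -` S) = 1"
proof -
  have inv: "\<nu> \<in> invariant_prob_measures f"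
    and erg: "\<And>B. B \<in> sets borel \<Longrightarrow> f -` B = B \<Longrightarrow> measure \<nu> B = 0 \<or> measure \<nu> B = 1"
    using \<nu> by (auto simp: ergodic_prob_measures_def)
  have sets: "sets \<nu> = sets borel" and prob: "prob_space \<nu>"
    using inv by (auto simp: invariant_prob_measures_def)
  interpret prob_space \<nu> by (rule prob)
  define G where "G = (\<Union>t. (f ^^ t) -` S)"
  define R where "R = (\<Inter>m. (f ^^ m) -` G)"
  have G: "G \<in> sets borel" unfolding G_def using vimage_funpow_borel[OF S(1)] by auto
  have R: "R \<in> sets borel" unfolding R_def using vimage_funpow_borel[OF G] by auto
  have G_back: "x \<in> G" if fx: "f x \<in> G" for x
  proof -
    obtain t where "(f ^^ t) (f x) \<in> S" using fx by (auto simp: G_def)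
    then have "(f ^^ Suc t) x \<in> S" by (simp add: funpow_swap1)
    then show ?thesis unfolding G_def by blast
  qed
  have "f -` R = R"
  proof (intro set_eqI iffI)
    fix x assume x: "x \<in> f -` R"
    then have fx: "(f ^^ m) (f x) \<in> G" for m by (simp add: R_def)
    have "(f ^^ m) x \<in> G" for m
    proof (cases m)
      case 0
      then show ?thesis using G_back[of x] fx[of 0] by simp
    next
      case (Suc k)
      then show ?thesis using fx[of k] by (simp add: funpow_swap1)
    qed
    then show "x \<in> R" by (simp add: R_def)
  next
    fix x assume "x \<in> R"
    then have "(f ^^ Suc m) x \<in> G" for m unfolding R_def by blast
    then show "x \<in> f -` R" by (simp add: R_def funpow_swap1)
  qed
  moreover have "measure \<nu> R = measure \<nu> G"
  proof -
    have "decseq (\<lambda>m. (f ^^ m) -` G)"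
      by (rule decseq_SucI) (auto intro: G_back)
    then have "(\<lambda>m. measure \<nu> ((f ^^ m) -` G)) \<longlonglongrightarrow> measure \<nu> R"
      unfolding R_def using vimage_funpow_borel[OF G] sets by (intro finite_Lim_measure_decseq) auto
    then show ?thesis
      by (simp add: invariant_measure_vimage_funpow[OF inv G] LIMSEQ_const_iff)
  qed
  moreover have "measure \<nu> S \<le> measure \<nu> G"
  proof (rule finite_measure_mono)
    show "S \<subseteq> G" unfolding G_def using UN_upper[of 0 UNIV "\<lambda>t. (f ^^ t) -` S"] by simp
  qed (use G sets in auto)
  ultimately show ?thesis using erg[OF R] S(2) unfolding G_def by auto
qed

end

section \<open>Cocycles over compact systems\<close>

locale continuous_cocycle = compact_dynamics f for f :: "'m::metric_space \<Rightarrow> 'm" +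
  fixes \<A> :: "'m \<Rightarrow> nat \<Rightarrow> 'x::real_normed_vector \<Rightarrow>\<^sub>L 'x"
  assumes cocycle: "cocycle_over f \<A>" and cont_A: "continuous_on UNIV (\<lambda>q. \<A> q 1)"
begin

lemma \<A>_zero: "\<A> q 0 = id_blinfun"
  and \<A>_add: "\<A> q (n + m) = \<A> ((f ^^ m) q) n o\<^sub>L \<A> q m"
  using cocycle by (auto simp: cocycle_over_def)

lemma norm_\<A>_add: "norm (\<A> q (n + m)) \<le> norm (\<A> ((f ^^ m) q) n) * norm (\<A> q m)"
  unfolding \<A>_add by (rule norm_blinfun_compose)

lemma cont_\<A>: "continuous_on UNIV (\<lambda>q. \<A> q n)"
proof (induction n)
  case (Suc n)
  have "continuous_on UNIV (\<lambda>q. \<A> ((f ^^ n) q) 1 o\<^sub>L \<A> q n)"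
    using continuous_on_compose2[OF cont_A cont_funpow, of n] Suc
    by (intro bounded_bilinear.continuous_on[OF bounded_bilinear_blinfun_compose]) auto
  then show ?case using \<A>_add[of _ 1 n] by simp
qed (simp add: \<A>_zero)

text \<open>At least 1, so that its powers increase with the exponent and its logarithm is
  nonnegative.\<close>

definition generator_bound :: real where
  "generator_bound = (SOME L. L \<ge> 1 \<and> (\<forall>q. norm (\<A> q 1) \<le> L))"

lemma generator_bound: "generator_bound \<ge> 1" "norm (\<A> q 1) \<le> generator_bound"
proof -
  obtain B where B: "\<And>q. norm (\<A> q 1) \<le> B"
    using compact_imp_bounded[OF compact_continuous_image[OF cont_A compact]] by (auto simp: bounded_iff)
  have "\<exists>L. L \<ge> 1 \<and> (\<forall>q. norm (\<A> q 1) \<le> L)"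
    by (rule exI[of _ "max 1 B"]) (use B in \<open>auto simp: le_max_iff_disj\<close>)
  from someI_ex[OF this, folded generator_bound_def]
  show "generator_bound \<ge> 1" "norm (\<A> q 1) \<le> generator_bound" by auto
qed

lemma norm_\<A>_le_power: "norm (\<A> q n) \<le> generator_bound ^ n"
proof (induction n)
  case (Suc n)
  have "norm (\<A> q (1 + n)) \<le> norm (\<A> ((f ^^ n) q) 1) * norm (\<A> q n)" by (rule norm_\<A>_add)
  also have "\<dots> \<le> generator_bound * generator_bound ^ n"
    using generator_bound Suc by (intro mult_mono) (auto intro: order_trans[OF zero_le_one])
  finally show ?case by simp
qed (simp add: \<A>_zero norm_blinfun_id_le)

lemma uniformly_exponentially_stableI:
  assumes N: "N > 0" and \<delta>: "\<delta> > 0" and le: "\<And>q. norm (\<A> q N) \<le> exp (- \<delta>)"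
  shows "uniformly_exponentially_stable \<A>"
  unfolding uniformly_exponentially_stable_def
proof (intro exI conjI allI)
  let ?L = generator_bound
  \<comment> \<open>The power of \<open>?L\<close> pays for the incomplete block of length j < N,
    and \<open>exp \<delta>\<close> for rounding n / N down to k.\<close>
  show "?L ^ N * exp \<delta> > 0" using generator_bound(1) by simp
  show "\<delta> / real N > 0" using N \<delta> by simp
  have blocks: "norm (\<A> q (k * N)) \<le> exp (- \<delta>) ^ k" for q k
  proof (induction k)
    case (Suc k)
    have "norm (\<A> q (N + k * N)) \<le> norm (\<A> ((f ^^ (k * N)) q) N) * norm (\<A> q (k * N))"
      by (rule norm_\<A>_add)
    also have "\<dots> \<le> exp (- \<delta>) * exp (- \<delta>) ^ k"
      using le Suc by (intro mult_mono) auto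
    finally show ?case by simp
  qed (simp add: \<A>_zero norm_blinfun_id_le)
  fix q n
  define k j where "k = n div N" and "j = n mod N"
  have n: "n = j + k * N" and j: "j < N" using N by (auto simp: k_def j_def)
  have "norm (\<A> q n) \<le> norm (\<A> ((f ^^ (k * N)) q) j) * norm (\<A> q (k * N))"
    unfolding n by (rule norm_\<A>_add)
  also have "\<dots> \<le> ?L ^ N * exp (- \<delta>) ^ k"
    using generator_bound(1) j
    by (intro mult_mono blocks order_trans[OF norm_\<A>_le_power power_increasing]) auto
  also have "exp (- \<delta>) ^ k = exp (- \<delta> * real k)"
    by (simp add: exp_of_nat_mult[symmetric] mult.commute)
  also have "\<dots> \<le> exp \<delta> * exp (- (\<delta> / real N) * real n)"
  proof -
    have "real n \<le> (real k + 1) * real N" using j by (simp add: n algebra_simps)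
    then have "\<delta> * real n \<le> \<delta> * ((real k + 1) * real N)" using \<delta> by simp
    then have "\<delta> / real N * real n \<le> \<delta> * (real k + 1)" using N by (simp add: field_simps)
    then show ?thesis unfolding exp_add[symmetric] by (simp add: algebra_simps)
  qed
  finally show "norm (\<A> q n) \<le> ?L ^ N * exp \<delta> * exp (- (\<delta> / real N) * real n)"
    using generator_bound(1) by (simp add: mult.assoc mult_left_mono)
qed

text \<open>Truncating the norm below at \<open>exp (- n)\<close> keeps the logarithm finite and subadditive.\<close>

definition log_norm :: "nat \<Rightarrow> 'm \<Rightarrow> real" where
  "log_norm n q = ln (max (norm (\<A> q n)) (exp (- real n)))"

lemma max_norm_pos: "max (norm (\<A> q n)) (exp (- real n)) > 0"
  by (simp add: less_max_iff_disj)

lemma log_norm_le_iff: "log_norm n q \<le> a \<longleftrightarrow> norm (\<A> q n) \<le> exp a \<and> - real n \<le> a"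
proof -
  have "log_norm n q \<le> a \<longleftrightarrow> max (norm (\<A> q n)) (exp (- real n)) \<le> exp a"
    unfolding log_norm_def using max_norm_pos[of q n] by (metis exp_le_cancel_iff exp_ln)
  then show ?thesis by simp
qed

lemma cont_log_norm: "continuous_on UNIV (log_norm n)"
  unfolding log_norm_def using max_norm_pos
  by (intro continuous_intros cont_\<A> ballI) (simp add: less_imp_neq[symmetric])

text \<open>On a trivial space the identity has norm 0; the truncation level \<open>exp 0\<close>
  still gives the value 0.\<close>

lemma log_norm_zero: "log_norm 0 q = 0"
  using norm_blinfun_id_le[where 'a = 'x] by (simp add: log_norm_def \<A>_zero max_absorb2)

lemma log_norm_ge: "- real n \<le> log_norm n q"
  using log_norm_le_iff[of n q "log_norm n q"] by simp

lemma log_norm_subadd: "log_norm (n + m) q \<le> log_norm n ((f ^^ m) q) + log_norm m q"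
  unfolding log_norm_le_iff
proof
  have le: "norm (\<A> q n) \<le> exp (log_norm n q)" for n q
    using log_norm_le_iff[of n q "log_norm n q"] by simp
  have "norm (\<A> q (n + m)) \<le> norm (\<A> ((f ^^ m) q) n) * norm (\<A> q m)" by (rule norm_\<A>_add)
  also have "\<dots> \<le> exp (log_norm n ((f ^^ m) q)) * exp (log_norm m q)"
    by (intro mult_mono le) auto
  finally show "norm (\<A> q (n + m)) \<le> exp (log_norm n ((f ^^ m) q) + log_norm m q)"
    by (simp add: exp_add)
  show "- real (n + m) \<le> log_norm n ((f ^^ m) q) + log_norm m q"
    using log_norm_ge[of n "(f ^^ m) q"] log_norm_ge[of m q] by simp
qed

theorem stable_or_nonneg_growth_measure:
  assumes "\<not> uniformly_exponentially_stable \<A>"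
  obtains \<nu> where "\<nu> \<in> ergodic_prob_measures f" "\<And>n. 0 \<le> integral\<^sup>L \<nu> (log_norm n)"
proof -
  have "\<exists>q. \<forall>y. log_norm n y \<le> log_norm n q" for n
    using continuous_attains_sup[OF compact _ cont_log_norm, of n] by auto
  then obtain q where q: "\<And>n y. log_norm n y \<le> log_norm n (q n)" by metis
  define R where "R = (\<lambda>n. log_norm n (q n) / real n) ` {0<..}"
  \<comment> \<open>Truncation keeps the quotients above -1, so the infimum is finite even where the
    cocycle vanishes. As an infimum of maxima it directly yields both growth conditions, and a
    negative value would give a uniform contraction at a single time.\<close>
  define \<gamma> where "\<gamma> = Inf R"
  have bdd: "bdd_below R"
    unfolding R_def by (rule bdd_belowI2[where m = "-1"]) (use log_norm_ge in \<open>auto simp: field_simps\<close>)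
  have "\<gamma> \<ge> 0"
  proof (rule ccontr)
    assume "\<not> \<gamma> \<ge> 0"
    then obtain n where n: "n > 0" "log_norm n (q n) / real n < 0"
      using cInf_lessD[of R 0] by (auto simp: \<gamma>_def R_def)
    define \<delta> where "\<delta> = - log_norm n (q n)"
    have "norm (\<A> y n) \<le> exp (- \<delta>)" for y
      using q[of n y] by (simp add: \<delta>_def log_norm_le_iff)
    moreover have "\<delta> > 0" using n by (simp add: \<delta>_def field_simps)
    ultimately show False using assms uniformly_exponentially_stableI n(1) by blast
  qed
  interpret subadditive_dynamics f log_norm \<gamma>
  proof
    fix n
    show "\<exists>q. real n * \<gamma> \<le> log_norm n q"
    proof (cases "n = 0")
      case False
      then have "\<gamma> \<le> log_norm n (q n) / real n"
        unfolding \<gamma>_def by (intro cInf_lower bdd) (auto simp: R_def)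
      then show ?thesis using False by (intro exI[of _ "q n"]) (simp add: field_simps)
    qed (simp add: log_norm_zero)
  next
    fix \<epsilon> :: real assume "\<epsilon> > 0"
    then have "\<exists>x\<in>R. x < \<gamma> + \<epsilon>"
      unfolding \<gamma>_def by (intro cInf_lessD) (auto simp: R_def)
    then obtain n where n: "n > 0" "log_norm n (q n) / real n < \<gamma> + \<epsilon>" by (auto simp: R_def)
    then have "log_norm n y \<le> real n * (\<gamma> + \<epsilon>)" for y
      using q[of n y] by (simp add: field_simps)
    then show "\<exists>n>0. \<forall>q. log_norm n q \<le> real n * (\<gamma> + \<epsilon>)" using n(1) by blast
  qed (rule cont_log_norm log_norm_zero log_norm_subadd)+
  obtain \<nu> where \<nu>: "\<nu> \<in> ergodic_prob_measures f" "\<And>n. real n * \<gamma> \<le> integral\<^sup>L \<nu> (log_norm n)"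
    using exists_ergodic_maximizing_measure by blast
  show thesis
  proof (rule that[OF \<nu>(1)])
    have "0 \<le> real n * \<gamma>" for n using \<open>\<gamma> \<ge> 0\<close> by simp
    then show "0 \<le> integral\<^sup>L \<nu> (log_norm n)" for n using \<nu>(2) order_trans by blast
  qed
qed

end

section \<open>Decay along visits to a set of uniform summability\<close>

lemma powr_le_powr_imp_le:
  fixes x y p :: real
  assumes "x powr p \<le> y powr p" "p > 0" "y \<ge> 0"
  shows "x \<le> y"
  using assms powr_less_mono2[of p y x] by force

text \<open>Partial sums stand in for the series, so no summability side conditions travel through
  the estimates.\<close>

locale datko_set = continuous_cocycle f \<A>
  for f :: "'m::metric_space \<Rightarrow> 'm" and \<A> :: "'m \<Rightarrow> nat \<Rightarrow> 'x::real_normed_vector \<Rightarrow>\<^sub>L 'x" +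
  fixes S :: "'m set" and K p :: real
  assumes K: "K \<ge> 1" and p: "p > 0"
    and sum_le: "q \<in> S \<Longrightarrow> (\<Sum>k\<le>n. norm (blinfun_apply (\<A> q k) x) powr p) \<le> (K * norm x) powr p"
begin

lemma norm_apply_le:
  assumes "q \<in> S"
  shows "norm (blinfun_apply (\<A> q n) x) \<le> K * norm x"
proof -
  have "norm (blinfun_apply (\<A> q n) x) powr p \<le> (\<Sum>k\<le>n. norm (blinfun_apply (\<A> q k) x) powr p)"
    by (rule member_le_sum) auto
  also have "\<dots> \<le> (K * norm x) powr p" by (rule sum_le[OF assms])
  finally show ?thesis using p K by (auto intro: powr_le_powr_imp_le)
qed

lemma norm_le: "q \<in> S \<Longrightarrow> norm (\<A> q n) \<le> K"
  using K norm_apply_le by (intro norm_blinfun_bound) auto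

definition visits :: "nat \<Rightarrow> 'm \<Rightarrow> nat" where
  "visits n q = (\<Sum>k<n. of_bool ((f ^^ k) q \<in> S))"

lemma visits_0: "visits 0 q = 0"
  and visits_Suc: "visits (Suc n) q = visits n q + of_bool ((f ^^ n) q \<in> S)"
  by (simp_all add: visits_def)

lemma visits_add: "visits (m + n) q = visits m q + visits n ((f ^^ m) q)"
proof (induction n)
  case (Suc n)
  have "(f ^^ n) ((f ^^ m) q) = (f ^^ (m + n)) q"
    by (simp add: funpow_add add.commute[of m n])
  with Suc show ?case by (simp add: visits_Suc)
qed (simp add: visits_0)

lemma visits_le: "visits n q \<le> n"
  by (induction n) (auto simp: visits_0 visits_Suc of_bool_def)

text \<open>Datko's argument: the orbit of a vector is at time \<open>n\<close> at most \<open>K\<close> times as large as at any earlier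
  visit to \<open>S\<close>, so many visits force it to be small compared with the \<open>p\<close>-sum along the orbit.\<close>

lemma visits_mult_powr_le:
  assumes q: "q \<in> S"
  shows "real (visits (Suc n) q) * norm (blinfun_apply (\<A> q n) x) powr p \<le> (K * (K * norm x)) powr p"
proof -
  let ?a = "norm (blinfun_apply (\<A> q n) x) powr p"
  have step: "of_bool ((f ^^ k) q \<in> S) * ?a \<le> K powr p * norm (blinfun_apply (\<A> q k) x) powr p"
    if "k \<le> n" for k
  proof (cases "(f ^^ k) q \<in> S")
    case True
    have "blinfun_apply (\<A> q n) x = blinfun_apply (\<A> ((f ^^ k) q) (n - k)) (blinfun_apply (\<A> q k) x)"
      using \<A>_add[of q "n - k" k] that by simp
    then have "norm (blinfun_apply (\<A> q n) x) \<le> K * norm (blinfun_apply (\<A> q k) x)"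
      using norm_apply_le[OF True] by simp
    then have "?a \<le> (K * norm (blinfun_apply (\<A> q k) x)) powr p"
      using p by (intro powr_mono2) auto
    then show ?thesis using True K by (simp add: powr_mult)
  qed simp
  have "real (visits (Suc n) q) * ?a = (\<Sum>k\<le>n. of_bool ((f ^^ k) q \<in> S) * ?a)"
    by (simp add: visits_def lessThan_Suc_atMost sum_distrib_right)
  also have "\<dots> \<le> (\<Sum>k\<le>n. K powr p * norm (blinfun_apply (\<A> q k) x) powr p)"
    using step by (intro sum_mono) auto
  also have "\<dots> = K powr p * (\<Sum>k\<le>n. norm (blinfun_apply (\<A> q k) x) powr p)"
    by (simp add: sum_distrib_left)
  also have "\<dots> \<le> K powr p * (K * norm x) powr p"
    using sum_le[OF q] by (intro mult_left_mono) auto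
  also have "\<dots> = (K * (K * norm x)) powr p" using K by (simp add: powr_mult)
  finally show ?thesis .
qed

text \<open>Dividing the bound of \<open>visits_mult_powr_le\<close> by
  \<open>(2 * K * K) powr p\<close> leaves the p-th power of half the norm of x.\<close>

definition halving_visits :: nat where
  "halving_visits = nat \<lceil>(2 * K * K) powr p\<rceil>"

lemma halving_visits: "(2 * K * K) powr p \<le> real halving_visits" "halving_visits > 0"
proof -
  show "(2 * K * K) powr p \<le> real halving_visits" by (simp add: halving_visits_def)
  moreover have "(2 * K * K) powr p > 0" using K by simp
  ultimately show "halving_visits > 0" by (cases halving_visits) auto
qed

lemma norm_le_half:
  assumes q: "q \<in> S" and v: "visits (Suc n) q \<ge> halving_visits"
  shows "norm (\<A> q n) \<le> 1 / 2"
proof (rule norm_blinfun_bound)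
  fix x
  let ?a = "norm (blinfun_apply (\<A> q n) x)"
  have "(2 * K * K * ?a) powr p = (2 * K * K) powr p * ?a powr p"
    using K by (simp add: powr_mult)
  also have "\<dots> \<le> real (visits (Suc n) q) * ?a powr p"
    using halving_visits(1) v by (intro mult_right_mono) auto
  also have "\<dots> \<le> (K * (K * norm x)) powr p" by (rule visits_mult_powr_le[OF q])
  finally have "2 * K * K * ?a \<le> K * (K * norm x)"
    by (rule powr_le_powr_imp_le) (use p K in auto)
  then have "(K * K) * (2 * ?a) \<le> (K * K) * norm x" by (simp add: algebra_simps)
  then have "2 * ?a \<le> norm x" using K by (subst (asm) mult_le_cancel_left_pos) auto
  then show "?a \<le> 1 / 2 * norm x" by simp
qed simp

text \<open>Normalized so that \<open>halving_visits\<close> visits are worth exactly the factor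
  1/2. Being at most 1, it keeps the decay estimate above the truncation level of
  \<open>log_norm\<close>.\<close>

definition decay_rate :: real where
  "decay_rate = ln 2 / real halving_visits"

lemma decay_rate: "decay_rate > 0" "decay_rate \<le> 1" "exp (- (decay_rate * real halving_visits)) = 1 / 2"
proof -
  show "decay_rate > 0" using halving_visits(2) by (simp add: decay_rate_def)
  have "ln 2 \<le> (1 :: real)" using ln_add_one_self_le_self[of 1] by simp
  also have "\<dots> \<le> real halving_visits" using halving_visits(2) by simp
  finally show "decay_rate \<le> 1" using halving_visits(2) by (simp add: decay_rate_def)
  have "decay_rate * real halving_visits = ln 2"
    using halving_visits(2) by (simp add: decay_rate_def)
  then show "exp (- (decay_rate * real halving_visits)) = 1 / 2"
    by (simp add: exp_minus inverse_eq_divide)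
qed

text \<open>With few visits the exponent is nonnegative and \<open>norm_le\<close> suffices.
  Otherwise the orbit is cut at a visit to \<open>S\<close> by which the norm has been halved, and
  the induction hypothesis applies from that point; cutting at a visit avoids a new factor K in each
  round.\<close>

lemma norm_decay:
  "q \<in> S \<Longrightarrow> norm (\<A> q n) \<le> K * exp (- decay_rate * (real (visits n q) - real halving_visits))"
proof (induction n arbitrary: q rule: less_induct)
  case (less n)
  show ?case
  proof (cases "visits n q \<le> halving_visits")
    case True
    then have "1 \<le> exp (- decay_rate * (real (visits n q) - real halving_visits))"
      using decay_rate(1) by (simp add: mult_nonneg_nonpos mult_nonpos_nonneg zero_le_mult_iff)
    then have "K * 1 \<le> K * exp (- decay_rate * (real (visits n q) - real halving_visits))"
      using K by (intro mult_left_mono) auto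
    with norm_le[OF less.prems, of n] show ?thesis by simp
  next
    case False
    \<comment> \<open>The time of visit number \<open>halving_visits + 1\<close>. As
      \<open>visits\<close> counts times strictly below its argument, \<open>Suc k\<close> includes
      time k, while exactly \<open>halving_visits\<close> visits precede it.\<close>
    define k where "k = (LEAST k. visits (Suc k) q > halving_visits)"
    obtain n' where n': "n = Suc n'" using False by (cases n) (auto simp: visits_0)
    have k: "visits (Suc k) q > halving_visits"
      using LeastI[of "\<lambda>k. visits (Suc k) q > halving_visits" n'] False n' by (simp add: k_def)
    have kn: "k \<le> n'"
      using Least_le[of "\<lambda>k. visits (Suc k) q > halving_visits" n'] False n' by (simp add: k_def)
    have vk: "visits k q \<le> halving_visits"
    proof (cases k)
      case (Suc j)
      then have "\<not> visits (Suc j) q > halving_visits"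
        using not_less_Least[of j "\<lambda>k. visits (Suc k) q > halving_visits"] by (simp add: k_def)
      then show ?thesis using Suc by simp
    qed (simp add: visits_0)
    have kS: "(f ^^ k) q \<in> S" and vk': "visits k q = halving_visits"
      using k vk by (auto simp: visits_Suc of_bool_def split: if_splits)
    have "k > 0" using vk' halving_visits(2) by (cases k) (auto simp: visits_0)
    then have lt: "n - k < n" using n' by simp
    have n: "n = k + (n - k)" using kn n' by simp
    have vn: "real (visits n q) = real halving_visits + real (visits (n - k) ((f ^^ k) q))"
      using visits_add[of k "n - k" q] n vk' by simp
    have "norm (\<A> q ((n - k) + k)) \<le> norm (\<A> ((f ^^ k) q) (n - k)) * norm (\<A> q k)"
      by (rule norm_\<A>_add)
    also have "\<dots> \<le> (K * exp (- decay_rate * (real (visits (n - k) ((f ^^ k) q)) - real halving_visits))) * (1 / 2)"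
      using k K by (intro mult_mono less.IH[OF lt kS] norm_le_half[OF less.prems]) auto
    also have "\<dots> = K * exp (- decay_rate * (real (visits n q) - real halving_visits))"
      unfolding decay_rate(3)[symmetric] vn by (simp add: exp_add[symmetric] algebra_simps)
    finally show ?thesis using n by (simp add: add.commute)
  qed
qed

text \<open>Up to the hit the norm grows at most by \<open>generator_bound ^ T\<close>, and at most
  T visits are lost from the count.\<close>

lemma norm_decay_after_hit:
  assumes t: "(f ^^ t) q \<in> S" "t \<le> T" and n: "T \<le> n"
  shows "norm (\<A> q n) \<le> generator_bound ^ T *
    (K * exp (- decay_rate * (real (visits n q) - real T - real halving_visits)))"
proof -
  have nt: "n = t + (n - t)" using t n by simp
  have v: "real (visits n q) \<le> real T + real (visits (n - t) ((f ^^ t) q))"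
    using visits_add[of t "n - t" q] nt visits_le[of t q] t(2) by simp
  have "norm (\<A> q ((n - t) + t)) \<le> norm (\<A> ((f ^^ t) q) (n - t)) * norm (\<A> q t)"
    by (rule norm_\<A>_add)
  also have "\<dots> \<le> (K * exp (- decay_rate * (real (visits (n - t) ((f ^^ t) q)) - real halving_visits)))
      * generator_bound ^ T"
    using K generator_bound(1) t(2)
    by (intro mult_mono norm_decay t(1) order_trans[OF norm_\<A>_le_power power_increasing]) auto
  also have "\<dots> \<le> (K * exp (- decay_rate * (real (visits n q) - real T - real halving_visits)))
      * generator_bound ^ T"
    using K generator_bound(1) v decay_rate(1)
    by (intro mult_right_mono mult_left_mono) (auto simp: mult_left_mono)
  finally show ?thesis using nt by (simp add: mult.commute add.commute)
qed

text \<open>One inequality for all points, ready for integration. Where \<open>S\<close> is not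
  reached by time T the crude bound is used; the additional n times \<open>decay_rate\<close> there
  offsets the subtracted visit term.\<close>

lemma log_norm_le_visits:
  assumes n: "T \<le> n"
  defines "Z \<equiv> real T * ln generator_bound + ln K + decay_rate * (real T + real halving_visits)"
  shows "log_norm n q \<le> Z - decay_rate * real (visits n q)
    + indicator (- (\<Union>t\<le>T. (f ^^ t) -` S)) q * (real n * (ln generator_bound + decay_rate))"
proof -
  have L: "ln generator_bound \<ge> 0" "generator_bound > 0" using generator_bound(1) by simp_all
  have Z: "Z \<ge> 0" unfolding Z_def using L K decay_rate(1) by (intro add_nonneg_nonneg mult_nonneg_nonneg) auto
  have cv: "decay_rate * real (visits n q) \<le> real n * decay_rate"
    using visits_le[of n q] decay_rate(1) by (simp add: mult.commute)
  have cn: "real n * decay_rate \<le> real n" using decay_rate(2) by (simp add: mult_left_le)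
  show ?thesis
  proof (cases "q \<in> (\<Union>t\<le>T. (f ^^ t) -` S)")
    case True
    then obtain t where t: "(f ^^ t) q \<in> S" "t \<le> T" by auto
    have "norm (\<A> q n) \<le> generator_bound ^ T *
      (K * exp (- decay_rate * (real (visits n q) - real T - real halving_visits)))"
      by (rule norm_decay_after_hit[OF t n])
    also have "generator_bound ^ T = exp (real T * ln generator_bound)"
      using L(2) by (simp add: exp_of_nat_mult)
    also have "K * exp (- decay_rate * (real (visits n q) - real T - real halving_visits)) =
        exp (ln K + - decay_rate * (real (visits n q) - real T - real halving_visits))"
      using K by (simp add: exp_diff exp_minus divide_inverse)
    finally have "norm (\<A> q n) \<le> exp (Z - decay_rate * real (visits n q))"
      by (simp add: Z_def exp_add[symmetric] algebra_simps)
    moreover have "- real n \<le> Z - decay_rate * real (visits n q)" using Z cv cn by linarith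
    ultimately have "log_norm n q \<le> Z - decay_rate * real (visits n q)" by (simp add: log_norm_le_iff)
    then show ?thesis using True by simp
  next
    case False
    have "norm (\<A> q n) \<le> exp (real n * ln generator_bound)"
      using norm_\<A>_le_power[of q n] L(2) by (simp add: exp_of_nat_mult)
    moreover have "- real n \<le> real n * ln generator_bound"
      using L(1) by (intro order_trans[OF _ mult_nonneg_nonneg]) auto
    ultimately have "log_norm n q \<le> real n * ln generator_bound" by (simp add: log_norm_le_iff)
    also have "\<dots> \<le> Z - decay_rate * real (visits n q) + real n * (ln generator_bound + decay_rate)"
      using Z cv by (simp add: algebra_simps)
    finally show ?thesis using False by simp
  qed
qed

theorem negative_growth:
  assumes \<nu>: "\<nu> \<in> ergodic_prob_measures f" and S: "S \<in> sets borel" "measure \<nu> S > 0"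
  shows "\<exists>n. integral\<^sup>L \<nu> (log_norm n) < 0"
proof (rule ccontr)
  assume "\<not> ?thesis"
  then have nonneg: "0 \<le> integral\<^sup>L \<nu> (log_norm n)" for n by (auto simp: not_less)
  have inv: "\<nu> \<in> invariant_prob_measures f" using \<nu> by (simp add: ergodic_prob_measures_def)
  have sets: "sets \<nu> = sets borel" and prob: "prob_space \<nu>"
    using inv by (auto simp: invariant_prob_measures_def)
  interpret prob_space \<nu> by (rule prob)
  have sp: "space \<nu> = UNIV" using sets_eq_imp_space_eq[OF sets] by simp
  define G where "G T = (\<Union>t\<le>T. (f ^^ t) -` S)" for T :: nat
  define a where "a = ln generator_bound + decay_rate"
  have G: "G T \<in> sets \<nu>" "- G T \<in> sets \<nu>" for T
    using vimage_funpow_borel[OF S(1)] unfolding G_def sets by auto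
  have fS: "(f ^^ k) -` S \<in> sets \<nu>" for k using vimage_funpow_borel[OF S(1)] sets by auto
  have ind: "integrable \<nu> (indicator B :: 'm \<Rightarrow> real)" if "B \<in> sets \<nu>" for B
    using that by (intro integrable_real_indicator) (auto simp: emeasure_eq_measure)
  have visits_eq: "real (visits n q) = (\<Sum>k<n. indicator ((f ^^ k) -` S) q)" for n q
    unfolding visits_def of_nat_sum by (rule sum.cong) (auto simp: indicator_def)
  have visits_int: "integrable \<nu> (\<lambda>q. real (visits n q))" for n
    unfolding visits_eq using ind[OF fS] by (intro Bochner_Integration.integrable_sum)
  have visits_integral: "(\<integral>q. real (visits n q) \<partial>\<nu>) = real n * measure \<nu> S" for n
    unfolding visits_eq
    using ind[OF fS] invariant_measure_vimage_funpow[OF inv S(1)]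
    by (subst Bochner_Integration.integral_sum) (auto simp: sp)
  have log_int: "integrable \<nu> (log_norm n)" for n
  proof -
    obtain B where "\<And>x. norm (log_norm n x) \<le> B"
      using compact_imp_bounded[OF compact_continuous_image[OF cont_log_norm compact], of n]
      by (auto simp: bounded_iff)
    moreover have "log_norm n \<in> borel_measurable \<nu>"
      using borel_measurable_continuous_onI[OF cont_log_norm] sets by (simp cong: measurable_cong_sets)
    ultimately show ?thesis by (intro integrable_const_bound) auto
  qed
  \<comment> \<open>For fixed T the integrated inequality is linear in n up to the constant Z, so
    its slope cannot have the wrong sign.\<close>
  have bound: "decay_rate * measure \<nu> S \<le> measure \<nu> (- G T) * a" for T
  proof (rule ccontr)
    assume neg: "\<not> ?thesis"
    define d where "d = decay_rate * measure \<nu> S - measure \<nu> (- G T) * a"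
    define Z where "Z = real T * ln generator_bound + ln K + decay_rate * (real T + real halving_visits)"
    have le: "real n * d \<le> Z" if n: "T \<le> n" for n
    proof -
      have "0 \<le> integral\<^sup>L \<nu> (log_norm n)" by (rule nonneg)
      also have "\<dots> \<le> (\<integral>q. Z - decay_rate * real (visits n q) + indicator (- G T) q * (real n * a) \<partial>\<nu>)"
        using log_norm_le_visits[OF n] log_int visits_int[of n] ind[OF G(2), of T]
        by (intro integral_mono) (auto simp: Z_def a_def G_def)
      also have "\<dots> = Z - decay_rate * (real n * measure \<nu> S) + measure \<nu> (- G T) * (real n * a)"
        using visits_int[of n] ind[OF G(2), of T] prob_space
        by (simp add: visits_integral sp)
      finally show ?thesis by (simp add: d_def algebra_simps)
    qed
    have "d > 0" using neg by (simp add: d_def)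
    then obtain n where "Z < real n * d" using reals_Archimedean3 by blast
    also have "real n * d \<le> real (max n T) * d" using \<open>d > 0\<close> by (intro mult_right_mono) auto
    finally show False using le[of "max n T"] by simp
  qed
  have "(\<lambda>T. measure \<nu> (G T)) \<longlonglongrightarrow> measure \<nu> (\<Union>T. G T)"
    using G by (intro finite_Lim_measure_incseq) (auto simp: G_def incseq_def intro: order_trans)
  also have "(\<Union>T. G T) = (\<Union>t. (f ^^ t) -` S)" by (auto simp: G_def)
  finally have "(\<lambda>T. measure \<nu> (G T)) \<longlonglongrightarrow> 1" using ergodic_visit_ae[OF \<nu> S] by simp
  then have "(\<lambda>T. (1 - measure \<nu> (G T)) * a) \<longlonglongrightarrow> (1 - 1) * a"
    by (intro tendsto_intros)
  moreover have "(1 - measure \<nu> (G T)) * a = measure \<nu> (- G T) * a" for T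
    using prob_compl[OF G(1), of T] by (simp add: sp Compl_eq_Diff_UNIV)
  ultimately have "(\<lambda>T. measure \<nu> (- G T) * a) \<longlonglongrightarrow> 0" by simp
  then have "decay_rate * measure \<nu> S \<le> 0" using bound by (intro LIMSEQ_le_const) auto
  then show False using decay_rate(1) S(2) by (simp add: mult_le_0_iff)
qed

end

section \<open>Summability from stability, and the equivalence\<close>

lemma uniformly_exponentially_stable_imp_summable:
  fixes \<A> :: "'m \<Rightarrow> nat \<Rightarrow> 'x::real_normed_vector \<Rightarrow>\<^sub>L 'x"
  assumes "uniformly_exponentially_stable \<A>"
  obtains D where "D > 0" "\<And>q x. summable (\<lambda>n. norm (blinfun_apply (\<A> q n) x) powr 1)"
    "\<And>q x. (\<Sum>n. norm (blinfun_apply (\<A> q n) x) powr 1) \<le> D * norm x"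
proof -
  obtain D l where D: "D > 0" "l > 0" "\<And>q n. norm (\<A> q n) \<le> D * exp (- l * real n)"
    using assms by (auto simp: uniformly_exponentially_stable_def)
  define r where "r = exp (- l)"
  have r: "0 < r" "r < 1" using D(2) by (auto simp: r_def)
  have le: "norm (blinfun_apply (\<A> q n) x) powr 1 \<le> D * norm x * r ^ n" for q n x
  proof -
    have "norm (blinfun_apply (\<A> q n) x) \<le> norm (\<A> q n) * norm x" by (rule norm_blinfun)
    also have "\<dots> \<le> (D * exp (- l * real n)) * norm x" by (intro mult_right_mono D(3)) simp
    also have "exp (- l * real n) = r ^ n"
      by (simp add: r_def exp_of_nat_mult[symmetric] mult.commute)
    finally show ?thesis by (simp add: mult_ac)
  qed
  have geo: "(\<lambda>n. D * norm x * r ^ n) sums (D * norm x * (1 / (1 - r)))" for x :: 'x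
    using r by (intro sums_mult geometric_sums) simp
  have sm: "summable (\<lambda>n. norm (blinfun_apply (\<A> q n) x) powr 1)" for q x
    by (rule summable_comparison_test'[OF sums_summable[OF geo[of x]], of 0]) (use le in auto)
  show thesis
  proof (rule that[OF _ sm])
    show "D * (1 / (1 - r)) > 0" using D(1) r by simp
    show "(\<Sum>n. norm (blinfun_apply (\<A> q n) x) powr 1) \<le> D * (1 / (1 - r)) * norm x" for q x
      using suminf_le[OF le sm sums_summable[OF geo[of x]]] sums_unique[OF geo[of x]] by (simp add: mult_ac)
  qed
qed

lemma partial_sum_powr_le:
  fixes u :: "nat \<Rightarrow> real"
  assumes "summable (\<lambda>n. u n powr p)" "(\<Sum>n. u n powr p) powr (1 / p) \<le> c" "p > 0" "c \<le> d"
  shows "(\<Sum>k\<le>n. u k powr p) \<le> d powr p"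
proof -
  let ?s = "\<Sum>n. u n powr p"
  have "(\<Sum>k\<le>n. u k powr p) \<le> ?s" using assms(1) by (intro sum_le_suminf) auto
  also have "?s = (?s powr (1 / p)) powr p"
    using suminf_nonneg[OF assms(1)] assms(3) by (simp add: powr_powr)
  also have "\<dots> \<le> d powr p" using assms by (intro powr_mono2) auto
  finally show ?thesis .
qed

theorem theorem3:
  fixes f :: "'m::metric_space \<Rightarrow> 'm"
    and \<A> :: "'m \<Rightarrow> nat \<Rightarrow> 'x::banach \<Rightarrow>\<^sub>L 'x"
  assumes compact_M: "compact (UNIV :: 'm set)"
    and cont_f: "continuous_on UNIV f"
    and separable_X: "separable_space (euclidean :: 'x topology)"
    and cocycle: "cocycle_over f \<A>"
    and cont_A: "continuous_on UNIV (\<lambda>q. \<A> q 1)"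
  shows "(\<exists>(C :: 'm \<Rightarrow> real) E (p :: real).
            C \<in> borel_measurable borel \<and> (\<forall>q. C q > 0) \<and> full_measure f E \<and> p > 0 \<and>
            (\<forall>q \<in> E. \<forall>x.
               summable (\<lambda>n. norm (blinfun_apply (\<A> q n) x) powr p) \<and>
               (\<Sum>n. norm (blinfun_apply (\<A> q n) x) powr p) powr (1 / p) \<le> C q * norm x))
         \<longleftrightarrow> uniformly_exponentially_stable \<A>"
    (is "?summable \<longleftrightarrow> _")
proof
  assume ?summable
  then obtain C E p where C: "C \<in> borel_measurable borel" and E: "full_measure f E" and p: "p > 0"
    and bound: "\<forall>q \<in> E. \<forall>x. summable (\<lambda>n. norm (blinfun_apply (\<A> q n) x) powr p) \<and>
      (\<Sum>n. norm (blinfun_apply (\<A> q n) x) powr p) powr (1 / p) \<le> C q * norm x"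
    by (elim exE conjE) (rule that)
  interpret continuous_cocycle f \<A>
    by unfold_locales (fact compact_M cont_f cocycle cont_A)+
  show "uniformly_exponentially_stable \<A>"
  proof (rule ccontr)
    assume "\<not> uniformly_exponentially_stable \<A>"
    then obtain \<nu> where \<nu>: "\<nu> \<in> ergodic_prob_measures f" "\<And>n. 0 \<le> integral\<^sup>L \<nu> (log_norm n)"
      by (rule stable_or_nonneg_growth_measure) (rule that)
    have sets: "sets \<nu> = sets borel" and "prob_space \<nu>"
      using \<nu>(1) by (auto simp: ergodic_prob_measures_def invariant_prob_measures_def)
    then interpret \<nu>: prob_space \<nu> by simp
    have EB: "E \<in> sets borel" "measure \<nu> E = 1" using E \<nu>(1) by (auto simp: full_measure_def)
    \<comment> \<open>The sublevel sets of C exhaust \<open>E\<close>, so one of them has positive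
      measure; \<open>Suc i\<close> makes the bound at least 1, as \<open>datko_set\<close>
      demands.\<close>
    define S where "S i = E \<inter> {q. C q \<le> real (Suc i)}" for i
    have S: "S i \<in> sets borel" for i
      unfolding S_def using C EB(1) by (intro sets.Int) (auto simp: borel_measurable_iff_le)
    have "(\<lambda>i. measure \<nu> (S i)) \<longlonglongrightarrow> measure \<nu> (\<Union>i. S i)"
      using S sets by (intro \<nu>.finite_Lim_measure_incseq) (auto simp: S_def incseq_def)
    also have "(\<Union>i. S i) = E"
    proof -
      have "\<exists>i. C q \<le> real (Suc i)" for q
      proof -
        obtain i where "C q \<le> real i" using real_arch_simple by blast
        then have "C q \<le> real (Suc i)" by simp
        then show ?thesis ..
      qed
      then show ?thesis by (auto simp: S_def)
    qed
    finally have "(\<lambda>i. measure \<nu> (S i)) \<longlonglongrightarrow> 1" using EB(2) by simp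
    then have "\<forall>\<^sub>F i in sequentially. 0 < measure \<nu> (S i)" by (rule order_tendstoD(1)) simp
    then obtain i where i: "0 < measure \<nu> (S i)" by (auto dest: eventually_happens)
    interpret datko_set f \<A> "S i" "real (Suc i)" p
    proof
      fix q n x assume q: "q \<in> S i"
      show "(\<Sum>k\<le>n. norm (blinfun_apply (\<A> q k) x) powr p) \<le> (real (Suc i) * norm x) powr p"
      proof (rule partial_sum_powr_le[OF _ _ p])
        show "summable (\<lambda>n. norm (blinfun_apply (\<A> q n) x) powr p)"
          "(\<Sum>n. norm (blinfun_apply (\<A> q n) x) powr p) powr (1 / p) \<le> C q * norm x"
          using bound q by (simp_all add: S_def)
        show "C q * norm x \<le> real (Suc i) * norm x"
          using q by (intro mult_right_mono) (auto simp: S_def)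
      qed
    qed (use p in auto)
    show False using negative_growth[OF \<nu>(1) S i] \<nu>(2) by (auto simp: not_less[symmetric])
  qed
next
  assume "uniformly_exponentially_stable \<A>"
  then obtain D where D: "D > 0" "\<And>q x. summable (\<lambda>n. norm (blinfun_apply (\<A> q n) x) powr 1)"
    "\<And>q x. (\<Sum>n. norm (blinfun_apply (\<A> q n) x) powr 1) \<le> D * norm x"
    by (rule uniformly_exponentially_stable_imp_summable) blast
  have "full_measure f UNIV"
    unfolding full_measure_def
  proof (intro conjI ballI)
    fix \<mu> assume "\<mu> \<in> ergodic_prob_measures f"
    then have "prob_space \<mu>" "sets \<mu> = sets borel"
      by (auto simp: ergodic_prob_measures_def invariant_prob_measures_def)
    then show "measure \<mu> UNIV = 1"
      using prob_space.prob_space[of \<mu>] sets_eq_imp_space_eq[of \<mu> borel] by simp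
  qed simp
  moreover have "(\<Sum>n. norm (blinfun_apply (\<A> q n) x) powr 1) powr (1 / 1) \<le> D * norm x" for q x
    using D(3)[of q x] suminf_nonneg[OF D(2)[of q x]] by simp
  ultimately show ?summable
    using D(1,2) by (intro exI[of _ "\<lambda>_. D"] exI[of _ UNIV] exI[of _ 1]) auto
qed

end
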